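(* Let $i,j,k$ be non-negative integers satisfying the triangle identities, i.e. $k\equiv i+j \bmod 2$, $i+k\ge j$, $j+k\ge i$, $i+j\ge k$, and put $$z=\tfrac{i+j-k}{2},\quad x=\tfrac{i+k-j}{2},\quad y=\tfrac{j+k-i}{2}.$$ Let $0\le r\le i$, $0\le s\le j$, $0\le t\le k$. Then: (i) The classical $3j$-symbol counts signed arrangements: $$C_{i,j}^k(r,s,t)_{q=1}=\sum_{a=0}^z(-1)^a\binom{z}{a}\binom{x}{r-a}\binom{y}{j-s-a}=(-1)^{\frac{i+j+k}{2}+r+s}\,\mathrm{Arr}^{i,j,k}_{r,s,t}.$$ (ii) The quantum $3j$-symbol counts weighted signed arrangements: $$C_{i,j}^k(r,s,t)=q^{-t(k-t)}\sum_{a=0}^z(-1)^a q^{-a}q^{\gamma_a}\begin{bmatrix} z \\ a \end{bmatrix}\begin{bmatrix} x \\ r-a \end{bmatrix}\begin{bmatrix} y \\ j-s-a \end{bmatrix},$$ where $$\gamma_a=\big((z-a)+(r-a)\big)(y-s+z-a)+(r-a)\big((x-r+a)+(z-a)\big)+a(z-a)+(j-s-a)(y-j+s+a).$$ The number $\gamma_a$ can be expressed in terms of $(i,j,k,r,s,t)$-arrangements: for such an arrangement with exactly $a$ arcs oriented from the $i$-side to the $j$-side, writing $N_{\alpha\beta}$ for the number of arcs oriented from the $\alpha$-side to the $\beta$-side, one has $$\gamma_a=N_{ji}N_{kj}+N_{ik}N_{kj}+N_{ik}N_{ki}+N_{ik}N_{ji}+N_{ij}N_{ji}+N_{kj}N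_{jk}.$$
   Context: Quantum numbers: $[m]=\sum_{l=0}^{m-1}q^{m-1-2l}$, $\begin{bmatrix} m \\ l \end{bmatrix}=\frac{[m]!}{[l]![m-l]!}$; binomials (classical or quantum) are zero if $l<0$ or $l>m$. $V_n$ is the $\mathbb C(q)$-vector space with basis $v_0,\dots,v_n$ (the irreducible $\mathcal U_q(\mathfrak{sl}_2)$-module of dimension $n+1$); its dual standard basis is $v^m=\begin{bmatrix} n \\ m \end{bmatrix}^{-1}v_m$. The evaluation form $\langle\cdot,\cdot\rangle$ on $V_n$ is the unique semi-linear form (anti-linear in the first variable, linear in the second) such that $\langle v_m,v^{m}\rangle=q^{m(n-m)}$ and $\langle v_m,v^{m'}\rangle=0$ for $m\ne m'$. For $\mathbf a\in\{0,1\}^n$ let $v_{\mathbf a}=v_{a_1}\otimes\cdots\otimes v_{a_n}\in V_1^{\otimes n}$, $|\mathbf a|=\sum a_p$, $l(\mathbf a)=\#\{p<p' : a_p<a_{p'}\}$, $b(\mathbf a)=\#\{p<p': a_p>a_{p'}\}$. Define $\pi_n:V_1^{\otimes n}\to V_n$, $\pi_n(v_{\mathbf a})=q^{-l(\mathbf a)}v^{|\mathbf a|}$, and $\iota_n:V_n\to V_1^{\otimes n}$, $\iota_n(v_m)=\sum_{|\mathbf a|=m}q^{b(\mathbf a)}v_{\mathbf a}$. The cap $\cap:V_1\otimes V_1\to\mathbb C(q)$ is given by $\cap(v_0\otimes v_0)=\cap(v_1\otimes v_1)=0$, $\cap(v_0\otimes v_1)=1$, $\cap(v_1\otimes v_0)=-q^{-1}$.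 The map $\Phi_{i,j}^k:V_1^{\otimes(i+j)}\to V_1^{\otimes k}$ is the identity on the first $x$ and the last $y$ tensor factors, and $z$ nested caps on the middle $2z$ factors (i.e. cap off factors $i,i+1$, then factors $i-1,i+2$, and so on). Put $A_{i,j}^k=\pi_k\circ\Phi_{i,j}^k\circ(\iota_i\otimes\iota_j):V_i\otimes V_j\to V_k$. The $3j$-symbol is $C_{i,j}^k(r,s,t)=\langle v_t,A_{i,j}^k(v_r\otimes v_s)\rangle$, with the evaluation form on $V_k$. The subscript $q=1$ means specialization at $q=1$ (the classical case). Arrangements: an $i,j,k$-triangle is a triangle with $i$, $j$, $k$ marked points on its three sides, called the $i$-, $j$- and $k$-side. A line arrangement is an isotopy class of collections of non-intersecting arcs inside the triangle whose end points are the marked points, each marked point being an end point of exactly one arc, and the end points of each arc lying on different sides. (It is unique; it has $z$ arcs joining the $i$- and $j$-sides, $x$ joining the $i$- and $k$-sides and $y$ joining the $j$- and $k$-sides.) An oriented line arrangement $L$ has every arc oriented. An arc is negatively oriented if it points from the $i$-side to the $j$-side, or from the $k$-side to the $i$-side or the $j$-side; otherwise it is positively oriented; $\mathrm{sgn}(L)=(-1)^{\#\text{negatively oriented arcs}}$. $L$ is an $(i,j,k,r,s,t)$-arrangement if exactly $r$ (resp. $s$) arcs have an end point on the $i$-side (resp. $j$-side) at which the orientation points into the interior of the triangle, and exactly $t$ arcs have an end point on the $k$-side at which the orientation points out of the triangle. $\mathrm{Arr}^{i,j,k}_{r,s,t}=\sum_L\mathrm{sgn}(L)$, summed over all $(i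,j,k,r,s,t)$-arrangements.
   Formalization: The explicit sums are asserted only for t=r+s-z (otherwise C=Arr=0, while the sums ignore t); with the given evaluation form C equals the sum without the factor q^{-t(k-t)}, and q^{-t(k-t)} times the sum is the coefficient of A(v_r⊗v_s) at v^t. *)

theory Defs
  imports
    "HOL-Computational_Algebra.Computational_Algebra"
    "HOL-Computational_Algebra.Field_as_Ring"
begin

type_synonym ratfun = "complex poly fract"

definition q :: ratfun where
  "q = to_fract [:0, 1:]"

text \<open>
  \<open>quot_of_fract\<close> yields numerator and denominator in lowest terms, so \<open>regular_at c f\<close> says that
  \<open>f\<close> has no pole at \<open>c\<close>, and only then is \<open>specialize c f\<close> meaningful.
\<close>

definition regular_at :: "complex \<Rightarrow> ratfun \<Rightarrow> bool" where
  "regular_at c f \<longleftrightarrow> poly (snd (quot_of_fract f)) c \<noteq> 0"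

definition specialize :: "complex \<Rightarrow> ratfun \<Rightarrow> complex" where
  "specialize c f = poly (fst (quot_of_fract f)) c / poly (snd (quot_of_fract f)) c"

lemma quot_of_fract_Fract_cross:
  assumes "b \<noteq> 0"
  shows "a * snd (quot_of_fract (Fract a b)) = b * fst (quot_of_fract (Fract a b))"
proof -
  obtain c d where cd: "quot_of_fract (Fract a b) = (c, d)" by (cases "quot_of_fract (Fract a b)")
  have "Fract c d = Fract a b"
    using quot_to_fract_quot_of_fract[of "Fract a b"] cd by (simp add: quot_to_fract_def)
  moreover have "d \<noteq> 0"
    using quot_of_fract_in_normalized_fracts[of "Fract a b"] cd by auto
  ultimately show ?thesis using assms cd by (simp add: eq_fract mult.commute)
qed

lemma
  assumes "poly b c \<noteq> 0"
  shows regular_at_Fract: "regular_at c (Fract a b)"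
    and specialize_Fract: "specialize c (Fract a b) = poly a c / poly b c"
proof -
  have b0: "b \<noteq> 0" using assms by auto
  obtain u v where uv: "quot_of_fract (Fract a b) = (u, v)" by (cases "quot_of_fract (Fract a b)")
  have cross: "a * v = b * u" using quot_of_fract_Fract_cross[OF b0, of a] uv by simp
  have cop: "coprime u v"
    using quot_of_fract_in_normalized_fracts[of "Fract a b"] uv by (simp add: normalized_fracts_def)
  have "v dvd b * u" using cross by (metis dvd_triv_right)
  then have "v dvd b" using cop by (simp add: coprime_commute coprime_dvd_mult_left_iff)
  then have v0: "poly v c \<noteq> 0" using assms by (auto elim!: dvdE)
  have "poly a c * poly v c = poly b c * poly u c" using cross by (metis poly_mult)
  then have "poly u c / poly v c = poly a c / poly b c"
    using assms v0 by (simp add: field_simps)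
  with v0 show "regular_at c (Fract a b)" "specialize c (Fract a b) = poly a c / poly b c"
    by (simp_all add: regular_at_def specialize_def uv)
qed

text \<open>
  The bar involution: the complex-linear field automorphism sending \<open>q\<close> to \<open>1 / q\<close>. Anti-linear
  means semi-linear with respect to it.
\<close>

definition subst_inverse :: "complex poly \<Rightarrow> ratfun" where
  "subst_inverse a = poly (map_poly (\<lambda>c. to_fract [:c:]) a) (inverse q)"

definition bar :: "ratfun \<Rightarrow> ratfun" where
  "bar f = subst_inverse (fst (quot_of_fract f)) / subst_inverse (snd (quot_of_fract f))"

lemma q_nonzero [simp]: "q \<noteq> 0"
  by (simp add: q_def)

lemma subst_inverse_0 [simp]: "subst_inverse 0 = 0"
  by (simp add: subst_inverse_def)

lemma subst_inverse_pCons [simp]: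
  "subst_inverse (pCons c a) = to_fract [:c:] + inverse q * subst_inverse a"
  by (simp add: subst_inverse_def map_poly_pCons)

lemma subst_inverse_1 [simp]: "subst_inverse 1 = 1"
  using subst_inverse_pCons[of 1 0] by (simp flip: one_pCons)

lemma subst_inverse_add: "subst_inverse (a + b) = subst_inverse a + subst_inverse b"
proof (induction a b rule: poly_induct2)
  case (pCons c a d b)
  have "to_fract [:c + d:] = to_fract [:c:] + to_fract [:d:]"
    by (simp flip: to_fract_add)
  with pCons show ?case by (simp add: algebra_simps)
qed simp

lemma subst_inverse_smult: "subst_inverse (smult c a) = to_fract [:c:] * subst_inverse a"
proof (induction a)
  case (pCons d a)
  have "to_fract [:c * d:] = to_fract [:c:] * to_fract [:d:]"
    by (simp flip: to_fract_mult)
  with pCons show ?case by (simp add: algebra_simps)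
qed simp

lemma subst_inverse_mult: "subst_inverse (a * b) = subst_inverse a * subst_inverse b"
  by (induction a) (simp_all add: subst_inverse_add subst_inverse_smult algebra_simps)

lemma subst_inverse_reflect: "subst_inverse a * q ^ degree a = to_fract (reflect_poly a)"
proof (induction a)
  case (pCons c a)
  have "to_fract (reflect_poly (pCons c a)) = to_fract (reflect_poly a) + to_fract (monom c (degree (pCons c a)))"
    if "a \<noteq> 0"
    using that by (simp add: reflect_poly_pCons' flip: to_fract_add)
  moreover have "to_fract (monom c n) = to_fract [:c:] * q ^ n" for n
  proof (induction n)
    case (Suc n)
    have "monom c (Suc n) = [:0, 1:] * monom c n" by (simp add: monom_Suc)
    then have "to_fract (monom c (Suc n)) = q * to_fract (monom c n)"
      unfolding q_def by (metis to_fract_mult)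
    with Suc show ?case by (simp add: algebra_simps)
  qed (simp add: monom_0)
  ultimately show ?case using pCons
    by (cases "a = 0") (auto simp: field_simps)
qed simp

lemma subst_inverse_eq_0_iff [simp]: "subst_inverse a = 0 \<longleftrightarrow> a = 0"
  using subst_inverse_reflect[of a] by (auto simp: reflect_poly_eq_0_iff)

lemma bar_Fract:
  assumes "b \<noteq> 0"
  shows "bar (Fract a b) = subst_inverse a / subst_inverse b"
proof -
  have "snd (quot_of_fract (Fract a b)) \<noteq> 0"
    using quot_of_fract_in_normalized_fracts[of "Fract a b"]
    by (metis not_normalized_fracts_0_denom prod.collapse)
  moreover have "subst_inverse a * subst_inverse (snd (quot_of_fract (Fract a b)))
      = subst_inverse b * subst_inverse (fst (quot_of_fract (Fract a b)))"
    by (simp add: quot_of_fract_Fract_cross[OF assms] flip: subst_inverse_mult)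
  ultimately show ?thesis
    using assms by (simp add: bar_def field_simps)
qed

lemma bar_0 [simp]: "bar 0 = 0" and bar_1 [simp]: "bar 1 = 1"
  using bar_Fract[of 1 0] bar_Fract[of 1 1] by (simp_all add: fract_collapse)

lemma bar_q: "bar q = inverse q"
  using bar_Fract[of 1 "[:0, 1:]"] by (simp add: q_def to_fract_def flip: one_pCons)

lemma bar_const: "bar (to_fract [:c:]) = to_fract [:c:]"
  using bar_Fract[of 1 "[:c:]"] by (simp add: to_fract_def)

lemma bar_add: "bar (f + g) = bar f + bar g"
proof -
  obtain a b c d where "f = Fract a b" "g = Fract c d" and nz: "b \<noteq> 0" "d \<noteq> 0"
    by (metis Fract_cases)
  then show ?thesis
    by (simp add: bar_Fract subst_inverse_add subst_inverse_mult field_simps)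
qed

lemma bar_mult: "bar (f * g) = bar f * bar g"
proof -
  obtain a b c d where "f = Fract a b" "g = Fract c d" and nz: "b \<noteq> 0" "d \<noteq> 0"
    by (metis Fract_cases)
  then show ?thesis
    by (simp add: bar_Fract subst_inverse_mult)
qed

definition qint :: "nat \<Rightarrow> ratfun" where
  "qint m = (\<Sum>l<m. q powi (int m - 1 - 2 * int l))"

definition qfact :: "nat \<Rightarrow> ratfun" where
  "qfact m = (\<Prod>l=1..m. qint l)"

text \<open>The lower index is an integer, both binomials being zero when it is negative.\<close>

definition qbinom :: "nat \<Rightarrow> int \<Rightarrow> ratfun" where
  "qbinom m l = (if 0 \<le> l \<and> l \<le> int m then qfact m / (qfact (nat l) * qfact (m - nat l)) else 0)"

definition ibinom :: "nat \<Rightarrow> int \<Rightarrow> int" where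
  "ibinom m l = (if 0 \<le> l \<and> l \<le> int m then int (m choose nat l) else 0)"

lemma qint_nonzero:
  assumes "0 < m"
  shows "qint m \<noteq> 0"
proof -
  have "q ^ (m - 1) * qint m = (\<Sum>l<m. q ^ (2 * (m - 1 - l)))"
    unfolding qint_def sum_distrib_left
  proof (rule sum.cong)
    fix l assume "l \<in> {..<m}"
    then have "int (m - 1) + (int m - 1 - 2 * int l) = int (2 * (m - 1 - l))" by auto
    then show "q ^ (m - 1) * q powi (int m - 1 - 2 * int l) = q ^ (2 * (m - 1 - l))"
      by (metis power_int_add power_int_of_nat q_nonzero)
  qed simp
  also have "\<dots> = to_fract (\<Sum>l<m. [:0, 1:] ^ (2 * (m - 1 - l)))"
  proof -
    have "to_fract (p ^ n) = to_fract p ^ n" for p :: "complex poly" and n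
      by (induction n) simp_all
    then show ?thesis by (simp add: q_def)
  qed
  also have "\<dots> \<noteq> 0"
  proof
    assume "to_fract (\<Sum>l<m. [:0, 1:] ^ (2 * (m - 1 - l)) :: complex poly) = 0"
    then have "poly (\<Sum>l<m. [:0, 1:] ^ (2 * (m - 1 - l)) :: complex poly) 1 = 0"
      by (metis poly_0 to_fract_eq_0_iff)
    then show False using assms by (simp add: poly_sum)
  qed
  finally show ?thesis by auto
qed

lemma qbinom_nonzero:
  assumes "l \<le> m"
  shows "qbinom m (int l) \<noteq> 0"
  using assms qint_nonzero by (auto simp: qbinom_def qfact_def)

text \<open>
  An element of \<open>V\<^sub>n\<close> is its coordinate function \<open>nat \<Rightarrow> ratfun\<close> with respect to the basis
  \<open>v\<^sub>0, \<dots>, v\<^sub>n\<close>. The dual standard basis vector \<open>v\<^sup>m\<close> is \<open>dual_vec n m\<close>,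
  and \<open>dual_coord n w m\<close> is the coefficient of \<open>w\<close> at \<open>v\<^sup>m\<close>. Since \<open>v\<^sub>m\<close> pairs with \<open>v\<^sup>m\<close> to
  \<open>q ^ (m * (n - m))\<close> and not to \<open>1\<close>, this coefficient differs by that factor from the value of
  the evaluation form on \<open>v\<^sub>m\<close> and \<open>w\<close>.
\<close>

definition V :: "nat \<Rightarrow> (nat \<Rightarrow> ratfun) set" where
  "V n = {v. \<forall>m>n. v m = 0}"

definition basis_vec :: "nat \<Rightarrow> nat \<Rightarrow> ratfun" where
  "basis_vec m = (\<lambda>m'. if m' = m then 1 else 0)"

definition dual_vec :: "nat \<Rightarrow> nat \<Rightarrow> nat \<Rightarrow> ratfun" where
  "dual_vec n m = (\<lambda>m'. inverse (qbinom n (int m)) * basis_vec m m')"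

definition dual_coord :: "nat \<Rightarrow> (nat \<Rightarrow> ratfun) \<Rightarrow> nat \<Rightarrow> ratfun" where
  "dual_coord n w m = qbinom n (int m) * w m"

lemma dual_coord_expansion:
  assumes "w \<in> V n"
  shows "w = (\<lambda>m'. \<Sum>m\<le>n. dual_coord n w m * dual_vec n m m')"
proof
  fix m'
  have "(\<Sum>m\<le>n. dual_coord n w m * dual_vec n m m') = (\<Sum>m\<le>n. if m = m' then w m else 0)"
    by (rule sum.cong) (auto simp: dual_coord_def dual_vec_def basis_vec_def qbinom_nonzero)
  also have "\<dots> = w m'"
    using assms by (auto simp: V_def sum.delta')
  finally show "w m' = (\<Sum>m\<le>n. dual_coord n w m * dual_vec n m m')" ..
qed

definition semilinear_form :: "nat \<Rightarrow> ((nat \<Rightarrow> ratfun) \<Rightarrow> (nat \<Rightarrow> ratfun) \<Rightarrow> ratfun) \<Rightarrow> bool" where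
  "semilinear_form n B \<longleftrightarrow>
    (\<forall>u\<in>V n. \<forall>v\<in>V n. \<forall>w\<in>V n. \<forall>c.
       B (\<lambda>m. u m + v m) w = B u w + B v w \<and> B (\<lambda>m. c * u m) w = bar c * B u w \<and>
       B w (\<lambda>m. u m + v m) = B w u + B w v \<and> B w (\<lambda>m. c * u m) = c * B w u)"

definition evaluation_form :: "nat \<Rightarrow> (nat \<Rightarrow> ratfun) \<Rightarrow> (nat \<Rightarrow> ratfun) \<Rightarrow> ratfun" where
  "evaluation_form n v w = (\<Sum>m\<le>n. bar (v m) * dual_coord n w m * q ^ (m * (n - m)))"

lemma semilinear_evaluation_form: "semilinear_form n (evaluation_form n)"
  by (auto simp: semilinear_form_def evaluation_form_def dual_coord_def bar_add bar_mult
      algebra_simps sum.distrib sum_distrib_left)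

lemma evaluation_form_basis:
  assumes "m \<le> n" "m' \<le> n"
  shows "evaluation_form n (basis_vec m) (dual_vec n m') = (if m = m' then q ^ (m * (n - m)) else 0)"
proof -
  have "evaluation_form n (basis_vec m) (dual_vec n m')
      = (\<Sum>p\<le>n. if p = m then (if m = m' then q ^ (m * (n - m)) else 0) else 0)"
    unfolding evaluation_form_def
    by (rule sum.cong)
      (use assms in \<open>auto simp: dual_coord_def dual_vec_def basis_vec_def qbinom_nonzero\<close>)
  with assms show ?thesis by simp
qed

lemma evaluation_form_unique:
  assumes B: "semilinear_form n B"
    and basis: "\<And>m m'. m \<le> n \<Longrightarrow> m' \<le> n \<Longrightarrow>
      B (basis_vec m) (dual_vec n m') = (if m = m' then q ^ (m * (n - m)) else 0)"
    and v: "v \<in> V n" and w: "w \<in> V n"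
  shows "B v w = evaluation_form n v w"
proof -
  have add1: "B (\<lambda>m. u m + v m) w = B u w + B v w" and scale1: "B (\<lambda>m. c * u m) w = bar c * B u w"
    and add2: "B w (\<lambda>m. u m + v m) = B w u + B w v" and scale2: "B w (\<lambda>m. c * u m) = c * B w u"
    if "u \<in> V n" "v \<in> V n" "w \<in> V n" for u v w c
    using B that unfolding semilinear_form_def by blast+
  have basis_V: "basis_vec m \<in> V n" "dual_vec n m \<in> V n" if "m \<le> n" for m
    using that by (auto simp: V_def basis_vec_def dual_vec_def)
  have sum_V: "(\<lambda>p. \<Sum>m<N. f m * g m p) \<in> V n" if "\<And>m. m < N \<Longrightarrow> g m \<in> V n" for N f g
    using that by (auto simp: V_def intro!: sum.neutral)
  have zero1: "B (\<lambda>_. 0) u = 0" and zero2: "B u (\<lambda>_. 0) = 0" if "u \<in> V n" for u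
    using scale1[OF that that that, of 0] scale2[OF that that that, of 0] by simp_all
  have sum1: "B (\<lambda>p. \<Sum>m<N. f m * g m p) u = (\<Sum>m<N. bar (f m) * B (g m) u)"
    if u: "u \<in> V n" and g: "\<And>m. m < N \<Longrightarrow> g m \<in> V n" for N :: nat and f g u
    using g
  proof (induction N)
    case (Suc N)
    have "(\<lambda>p. f N * g N p) \<in> V n" using Suc.prems[of N] by (auto simp: V_def)
    then show ?case
      using Suc add1[OF sum_V _ u, of N g "\<lambda>p. f N * g N p" f] scale1[OF _ u u, of "g N" "f N"] by simp
  qed (simp add: zero1 u)
  have sum2: "B u (\<lambda>p. \<Sum>m<N. f m * g m p) = (\<Sum>m<N. f m * B u (g m))"
    if u: "u \<in> V n" and g: "\<And>m. m < N \<Longrightarrow> g m \<in> V n" for N :: nat and f g u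
    using g
  proof (induction N)
    case (Suc N)
    have "(\<lambda>p. f N * g N p) \<in> V n" using Suc.prems[of N] by (auto simp: V_def)
    then show ?case
      using Suc add2[OF sum_V _ u, of N g "\<lambda>p. f N * g N p" f] scale2[OF _ u u, of "g N" "f N"] by simp
  qed (simp add: zero2 u)
  have "v = (\<lambda>p. \<Sum>m<Suc n. v m * basis_vec m p)"
    using v by (force simp: V_def basis_vec_def if_distrib[of "(*) _"] sum.delta' cong: if_cong)
  then have "B v w = (\<Sum>m<Suc n. bar (v m) * B (basis_vec m) w)"
    using sum1[OF w, of "Suc n" basis_vec v] basis_V(1) by (simp only: less_Suc_eq_le)
  also have "\<dots> = (\<Sum>m<Suc n. bar (v m) * (dual_coord n w m * q ^ (m * (n - m))))"
  proof (rule sum.cong)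
    fix m assume m: "m \<in> {..<Suc n}"
    have "B (basis_vec m) w = (\<Sum>m'<Suc n. dual_coord n w m' * B (basis_vec m) (dual_vec n m'))"
      using sum2[of "basis_vec m" "Suc n" "dual_vec n" "dual_coord n w"] basis_V m
        dual_coord_expansion[OF w] by (simp only: lessThan_Suc_atMost less_Suc_eq_le atMost_iff)
    also have "\<dots> = (\<Sum>m'<Suc n. if m' = m then dual_coord n w m * q ^ (m * (n - m)) else 0)"
      by (rule sum.cong) (use m basis in \<open>auto simp: less_Suc_eq_le\<close>)
    finally show "bar (v m) * B (basis_vec m) w
        = bar (v m) * (dual_coord n w m * q ^ (m * (n - m)))" using m by simp
  qed simp
  finally show ?thesis
    by (simp add: evaluation_form_def lessThan_Suc_atMost mult.assoc)
qed

text \<open>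
  An element of the \<open>n\<close>-th tensor power of \<open>V\<^sub>1\<close> is its coordinate function on bit strings of
  length \<open>n\<close> (zero on all other lists), \<open>True\<close> standing for \<open>v\<^sub>1\<close> and \<open>False\<close> for \<open>v\<^sub>0\<close>.
  Similarly, an element of \<open>V\<^sub>i \<otimes> V\<^sub>j\<close> is a function on pairs of indices.
\<close>

type_synonym tensor = "bool list \<Rightarrow> ratfun"

definition ones :: "bool list \<Rightarrow> nat" where
  "ones a = count_list a True"

definition ascents :: "bool list \<Rightarrow> nat" where
  "ascents a = card {(p, p'). p < p' \<and> p' < length a \<and> a ! p < a ! p'}"

definition descents :: "bool list \<Rightarrow> nat" where
  "descents a = card {(p, p'). p < p' \<and> p' < length a \<and> a ! p > a ! p'}"

definition proj :: "nat \<Rightarrow> tensor \<Rightarrow> nat \<Rightarrow> ratfun" where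
  "proj n w = (\<lambda>m. \<Sum>a | length a = n. w a * (q powi (- int (ascents a)) * dual_vec n (ones a) m))"

definition incl_basis :: "nat \<Rightarrow> nat \<Rightarrow> tensor" where
  "incl_basis n m = (\<lambda>a. if length a = n \<and> ones a = m then q ^ descents a else 0)"

definition incl2 :: "nat \<Rightarrow> nat \<Rightarrow> (nat \<times> nat \<Rightarrow> ratfun) \<Rightarrow> tensor" where
  "incl2 i j u = (\<lambda>a. \<Sum>m\<le>i. \<Sum>m'\<le>j.
     u (m, m') * (incl_basis i m (take i a) * incl_basis j m' (drop i a)))"

fun cap :: "bool \<Rightarrow> bool \<Rightarrow> ratfun" where
  "cap False False = 0"
| "cap True True = 0"
| "cap False True = 1"
| "cap True False = - inverse q"

text \<open>
  \<open>cap_at p\<close> caps off the two tensor factors following the first \<open>p\<close>, and \<open>nested_caps x z\<close> the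
  \<open>2 * z\<close> factors following the first \<open>x\<close>, starting with the two in the middle.
\<close>

definition cap_at :: "nat \<Rightarrow> tensor \<Rightarrow> tensor" where
  "cap_at p w = (\<lambda>a. \<Sum>c\<in>UNIV. \<Sum>d\<in>UNIV. cap c d * w (take p a @ [c, d] @ drop p a))"

primrec nested_caps :: "nat \<Rightarrow> nat \<Rightarrow> tensor \<Rightarrow> tensor" where
  "nested_caps x 0 w = w"
| "nested_caps x (Suc z) w = nested_caps x z (cap_at (x + z) w)"

definition Phi :: "nat \<Rightarrow> nat \<Rightarrow> nat \<Rightarrow> tensor \<Rightarrow> tensor" where
  "Phi i j k = nested_caps ((i + k - j) div 2) ((i + j - k) div 2)"

definition intertwiner :: "nat \<Rightarrow> nat \<Rightarrow> nat \<Rightarrow> (nat \<times> nat \<Rightarrow> ratfun) \<Rightarrow> nat \<Rightarrow> ratfun" where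
  "intertwiner i j k u = proj k (Phi i j k (incl2 i j u))"

definition basis_tensor :: "nat \<Rightarrow> nat \<Rightarrow> nat \<times> nat \<Rightarrow> ratfun" where
  "basis_tensor r s = (\<lambda>(m, m'). basis_vec r m * basis_vec s m')"

definition threej :: "nat \<Rightarrow> nat \<Rightarrow> nat \<Rightarrow> nat \<Rightarrow> nat \<Rightarrow> nat \<Rightarrow> ratfun" where
  "threej i j k r s t = evaluation_form k (basis_vec t) (intertwiner i j k (basis_tensor r s))"

text \<open>
  The marked points are numbered \<open>0, \<dots>, i + j + k - 1\<close> in the cyclic order in which they occur on
  the boundary of the triangle: first those on the i-side, then the j-side, then the k-side.
  Collections of non-intersecting arcs joining boundary points of a disc are determined up to
  isotopy by which points are joined, and a perfect matching of the points arises in this way iff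
  no two of its pairs separate each other on the boundary circle. An isotopy class is therefore
  represented by the set of its two-element sets of end points.
\<close>

datatype side = ISide | JSide | KSide

definition side_of :: "nat \<Rightarrow> nat \<Rightarrow> nat \<Rightarrow> side" where
  "side_of i j p = (if p < i then ISide else if p < i + j then JSide else KSide)"

definition line_arrangement :: "nat \<Rightarrow> nat \<Rightarrow> nat \<Rightarrow> nat set set \<Rightarrow> bool" where
  "line_arrangement i j k M \<longleftrightarrow>
    (\<forall>\<alpha>\<in>M. \<exists>p p'. \<alpha> = {p, p'} \<and> p < i + j + k \<and> p' < i + j + k \<and> side_of i j p \<noteq> side_of i j p') \<and>
    (\<forall>p < i + j + k. \<exists>!\<alpha>. \<alpha> \<in> M \<and> p \<in> \<alpha>) \<and>
    (\<forall>a b c d. a < b \<and> b < c \<and> c < d \<longrightarrow> \<not> ({a, c} \<in> M \<and> {b, d} \<in> M))"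

text \<open>An oriented arc is the pair of its source and its target.\<close>

definition oriented_arrangement :: "nat \<Rightarrow> nat \<Rightarrow> nat \<Rightarrow> (nat \<times> nat) set \<Rightarrow> bool" where
  "oriented_arrangement i j k L \<longleftrightarrow>
    line_arrangement i j k ((\<lambda>(p, p'). {p, p'}) ` L) \<and> inj_on (\<lambda>(p, p'). {p, p'}) L"

definition arcs_from_to :: "nat \<Rightarrow> nat \<Rightarrow> (nat \<times> nat) set \<Rightarrow> side \<Rightarrow> side \<Rightarrow> nat" where
  "arcs_from_to i j L A B = card {(p, p') \<in> L. side_of i j p = A \<and> side_of i j p' = B}"

definition negative_arc :: "nat \<Rightarrow> nat \<Rightarrow> nat \<times> nat \<Rightarrow> bool" where
  "negative_arc i j = (\<lambda>(p, p'). (side_of i j p, side_of i j p')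
     \<in> {(ISide, JSide), (KSide, ISide), (KSide, JSide)})"

definition arrangement_sign :: "nat \<Rightarrow> nat \<Rightarrow> (nat \<times> nat) set \<Rightarrow> int" where
  "arrangement_sign i j L = (-1) ^ card {e \<in> L. negative_arc i j e}"

definition arrangement ::
    "nat \<Rightarrow> nat \<Rightarrow> nat \<Rightarrow> nat \<Rightarrow> nat \<Rightarrow> nat \<Rightarrow> (nat \<times> nat) set \<Rightarrow> bool" where
  "arrangement i j k r s t L \<longleftrightarrow> oriented_arrangement i j k L \<and>
     card {e \<in> L. side_of i j (fst e) = ISide} = r \<and>
     card {e \<in> L. side_of i j (fst e) = JSide} = s \<and>
     card {e \<in> L. side_of i j (snd e) = KSide} = t"

definition Arr :: "nat \<Rightarrow> nat \<Rightarrow> nat \<Rightarrow> nat \<Rightarrow> nat \<Rightarrow> nat \<Rightarrow> int" where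
  "Arr i j k r s t = (\<Sum>L | arrangement i j k r s t L. arrangement_sign i j L)"

lemma oriented_arrangement_subset:
  assumes "oriented_arrangement i j k L"
  shows "L \<subseteq> {..<i + j + k} \<times> {..<i + j + k}"
proof
  fix e assume "e \<in> L"
  then obtain p p' where e: "e = (p, p')" "{p, p'} \<in> (\<lambda>(p, p'). {p, p'}) ` L"
    by (cases e) force
  with assms obtain u u' where "{p, p'} = {u, u'}" "u < i + j + k" "u' < i + j + k"
    unfolding oriented_arrangement_def line_arrangement_def by metis
  with e show "e \<in> {..<i + j + k} \<times> {..<i + j + k}" by (auto simp: doubleton_eq_iff)
qed

lemma finite_arrangements: "finite {L. arrangement i j k r s t L}"
  by (rule finite_subset[of _ "Pow ({..<i + j + k} \<times> {..<i + j + k})"])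
    (auto simp: arrangement_def dest!: oriented_arrangement_subset)

definition exponent :: "int \<Rightarrow> int \<Rightarrow> int \<Rightarrow> int \<Rightarrow> int \<Rightarrow> int \<Rightarrow> int \<Rightarrow> int" where
  "exponent x y z j r s a =
     ((z - a) + (r - a)) * (y - s + z - a) + (r - a) * ((x - r + a) + (z - a))
     + a * (z - a) + (j - s - a) * (y - j + s + a)"

end

theory Submission
  imports Defs
begin

text \<open>
  Expanding the intertwiner over bit strings, the nested caps force the \<open>2 * z\<close> middle factors to read
  \<open>u @ rev (map Not u)\<close>, so a term of the \<open>3j\<close>-symbol is a triple of bit strings of lengths \<open>x\<close>, \<open>y\<close>
  and \<open>z\<close>. Up to a sign and a power of \<open>q\<close> that depend only on the numbers of ones, its weight is a
  product of the factors \<open>q powi (descents - ascents)\<close> of the three strings, and summing such a factor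
  over the strings with \<open>m\<close> ones gives a quantum binomial. On the other side, an orientation of the unique
  line arrangement is a choice of a subset of each of its three bundles of arcs.
\<close>

text \<open>The sums in the theorem do not involve \<open>t\<close>, whereas a state contributes
  only if \<open>t + z = r + s\<close>: every cap meets exactly one \<open>v_1\<close>, so
  \<open>z\<close> of the \<open>r + s\<close> entering ones are absorbed. The closed formulas are
  therefore proved under this weight condition, and off it the symbol and the signed count are each
  shown to vanish, so that their comparison at q = 1 covers every \<open>t\<close>. The evaluation
  form contributes \<open>q ^ (t * (k - t))\<close>. Hence the inverse power of q belongs to the
  coordinate at the dual basis and cancels in \<open>threej\<close>. Both inclusions read the cap
  string \<open>u\<close>, which gives \<open>2 * descents u\<close>. This exceeds the balanced
  weight \<open>descents u - ascents u\<close> by \<open>a * (z - a)\<close>, where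
  \<open>a = ones u\<close>, and that excess is the origin of the summand \<open>a * (z - a)\<close>
  of gamma. Up to the final theorem everything is written in terms of x, y, z, with i = x + z, j = z
  + y, k = x + y, so that parity conditions and halves disappear.\<close>

section \<open>Quantum binomials\<close>

text \<open>The exponents of \<open>qint (a + b)\<close> form one descending string of step 2. Its
  first \<open>a\<close> entries are centred at \<open>b\<close>, its last \<open>b\<close> entries
  at \<open>- a\<close>.\<close>

lemma qint_add: "qint (a + b) = q powi int b * qint a + q powi (- int a) * qint b"
proof -
  have "qint (a + b) = (\<Sum>l<a. q powi (int (a + b) - 1 - 2 * int l))
      + (\<Sum>l<b. q powi (int (a + b) - 1 - 2 * int (l + a)))"
    unfolding qint_def lessThan_atLeast0
    using sum.atLeastLessThan_concat[of 0 a "a + b" "\<lambda>l. q powi (int (a + b) - 1 - 2 * int l)"]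
      sum.shift_bounds_nat_ivl[where m = 0 and k = a and n = b and g = "\<lambda>l. q powi (int (a + b) - 1 - 2 * int l)"]
    by (simp add: add.commute)
  also have "(\<Sum>l<a. q powi (int (a + b) - 1 - 2 * int l)) = q powi int b * qint a"
    unfolding qint_def sum_distrib_left
    by (intro sum.cong refl) (simp flip: power_int_add power_int_of_nat add: algebra_simps)
  also have "(\<Sum>l<b. q powi (int (a + b) - 1 - 2 * int (l + a))) = q powi (- int a) * qint b"
    unfolding qint_def sum_distrib_left
    by (intro sum.cong refl) (simp flip: power_int_add power_int_of_nat add: algebra_simps)
  finally show ?thesis .
qed

lemma qfact_0 [simp]: "qfact 0 = 1"
  by (simp add: qfact_def)

lemma qfact_Suc [simp]: "qfact (Suc n) = qint (Suc n) * qfact n"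
  by (simp add: qfact_def mult.commute)

lemma qfact_nonzero [simp]: "qfact n \<noteq> 0"
  by (induction n) (auto simp: qint_nonzero)

lemma qbinom_eq_0: "m < 0 \<or> int n < m \<Longrightarrow> qbinom n m = 0"
  by (auto simp: qbinom_def)

lemma qbinom_int: "m \<le> n \<Longrightarrow> qbinom n (int m) = qfact n / (qfact m * qfact (n - m))"
  by (simp add: qbinom_def)

lemma qbinom_0_right [simp]: "qbinom n 0 = 1"
  using qbinom_int[of 0 n] by simp

lemma qbinom_self [simp]: "qbinom n (int n) = 1"
  by (simp add: qbinom_int)

lemma qbinom_symmetric: "qbinom n (int n - m) = qbinom n m"
proof (cases "0 \<le> m \<and> m \<le> int n")
  case True
  then obtain l where "m = int l" "l \<le> n"
    by (metis nonneg_int_cases of_nat_le_iff)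
  then show ?thesis
    by (simp add: qbinom_int flip: of_nat_diff)
qed (auto simp: qbinom_def)

text \<open>The q-Pascal rule, with the weights that a new first bit brings: a leading one gains
  \<open>n + 1 - m\<close> descents, a leading zero gains \<open>m\<close> ascents. In the interior
  it is \<open>qint_add\<close> for n + 1 = m + (n + 1 - m), divided by factorials.\<close>

lemma qbinom_Suc:
  "qbinom (Suc n) m = q powi (int n + 1 - m) * qbinom n (m - 1) + q powi (- m) * qbinom n m"
proof -
  \<comment> \<open>The quotient of factorials represents all three binomials only for 0 < m <= n.
    There \<open>d = n - m\<close>, which keeps truncated subtraction out of the
    computation.\<close>
  consider "m < 0 \<or> m > int (Suc n)" | "m = 0" | "m = int (Suc n)" | l d where "m = int (Suc l)" "n = l + d + 1"
  proof -
    assume a: "m < 0 \<or> m > int (Suc n) \<Longrightarrow> thesis" "m = 0 \<Longrightarrow> thesis" "m = int (Suc n) \<Longrightarrow> thesis"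
      "\<And>l d. m = int (Suc l) \<Longrightarrow> n = l + d + 1 \<Longrightarrow> thesis"
    show thesis
    proof (cases "0 < m \<and> m < int (Suc n)")
      case True
      then have "m = int (Suc (nat (m - 1)))" "n = nat (m - 1) + nat (int n - m) + 1" by auto
      then show ?thesis by (rule a(4))
    next
      case False
      then show ?thesis using a(1-3) by linarith
    qed
  qed
  then show ?thesis
  proof cases
    case 1
    then show ?thesis by (auto simp: qbinom_eq_0)
  next
    case 2
    then show ?thesis by (simp add: qbinom_eq_0)
  next
    case 3
    then show ?thesis using qbinom_self[of "Suc n"] by (simp add: qbinom_eq_0 del: of_nat_Suc) simp
  next
    case 4
    have "qint (Suc n) = q powi int (Suc d) * qint (Suc l) + q powi (- m) * qint (Suc d)"
      using qint_add[of "Suc l" "Suc d"] 4 by (simp add: add.commute)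
    then have "qbinom (Suc n) m
      = (q powi int (Suc d) * qint (Suc l) + q powi (- m) * qint (Suc d)) * qfact n / (qfact (Suc l) * qfact (Suc d))"
      using 4 qbinom_int[of "Suc l" "Suc n"] by simp
    also have "\<dots> = q powi int (Suc d) * (qfact n / (qfact l * qfact (Suc d)))
       + q powi (- m) * (qfact n / (qfact (Suc l) * qfact d))"
    proof -
      have "(u * A + v * B) * N / ((A * F) * (B * G)) = u * (N / (F * (B * G))) + v * (N / ((A * F) * G))"
        if "A \<noteq> 0" "B \<noteq> 0" "F \<noteq> 0" "G \<noteq> 0" for u v A B F G N :: ratfun
        using that by (simp add: field_simps)
      then show ?thesis
        unfolding qfact_Suc using qint_nonzero[of "Suc l"] qint_nonzero[of "Suc d"] by simp
    qed
    also have "qfact n / (qfact l * qfact (Suc d)) = qbinom n (m - 1)"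
      using 4 qbinom_int[of l n] by simp
    also have "qfact n / (qfact (Suc l) * qfact d) = qbinom n m"
      using 4 qbinom_int[of "Suc l" n] by simp
    also have "int (Suc d) = int n + 1 - m"
      using 4 by simp
    finally show ?thesis .
  qed
qed

section \<open>Bit strings\<close>

lemma finite_bit_strings [simp]: "finite {a :: bool list. length a = n}"
  using finite_lists_length_eq[of "UNIV :: bool set" n] by simp

lemma sum_bit_strings_0: "(\<Sum>a | length a = 0. f (a :: bool list)) = f []"
  by simp

lemma sum_bit_strings_Suc:
  fixes f :: "bool list \<Rightarrow> 'a :: comm_monoid_add"
  shows "(\<Sum>a | length a = Suc n. f a)
    = (\<Sum>a | length a = n. f (True # a)) + (\<Sum>a | length a = n. f (False # a))"
proof -
  have "{a. length a = Suc n} = (#) True ` {a. length a = n} \<union> (#) False ` {a. length a = n}"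
    by (auto simp: length_Suc_conv image_iff)
  then have "(\<Sum>a | length a = Suc n. f a)
      = sum f ((#) True ` {a. length a = n}) + sum f ((#) False ` {a. length a = n})"
    by (simp only:) (rule sum.union_disjoint, auto)
  then show ?thesis by (simp add: sum.reindex)
qed

lemma sum_bit_strings_append:
  fixes f :: "bool list \<Rightarrow> 'a :: comm_monoid_add"
  shows "(\<Sum>a | length a = m + n. f a) = (\<Sum>b | length b = m. \<Sum>c | length c = n. f (b @ c))"
  by (induction m arbitrary: f) (simp_all add: sum_bit_strings_Suc)

lemma sum_bit_strings_snoc:
  fixes f :: "bool list \<Rightarrow> 'a :: comm_monoid_add"
  shows "(\<Sum>a | length a = Suc n. f a)
    = (\<Sum>a | length a = n. f (a @ [True]) + f (a @ [False]))"
  using sum_bit_strings_append[where m = n and n = "Suc 0" and f = f] by (simp add: sum_bit_strings_Suc)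

lemma ones_simps [simp]:
  "ones [] = 0" "ones (c # a) = of_bool c + ones a" "ones (a @ b) = ones a + ones b"
  "ones (rev a) = ones a"
  by (simp_all add: ones_def)

lemma ones_le_length: "ones a \<le> length a"
  by (simp add: ones_def count_le_length)

lemma ones_map_Not: "ones (map Not a) = length a - ones a"
  by (induction a) (auto simp: Suc_diff_le ones_le_length)

section \<open>Ascents and descents\<close>

text \<open>Pairs with first index 0 are split off; all others are shifted pairs of the tail. A
  general relation \<open>R\<close> serves ascents and descents alike.\<close>

lemma card_pairs_Cons:
  "card {(p, p'). p < p' \<and> p' < length (c # a) \<and> R ((c # a) ! p) ((c # a) ! p')}
    = card {(p, p'). p < p' \<and> p' < length a \<and> R (a ! p) (a ! p')} + length (filter (R c) a)"
proof -
  let ?S = "{(p, p'). p < p' \<and> p' < length a \<and> R (a ! p) (a ! p')}"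
  let ?H = "{p. p < length a \<and> R c (a ! p)}"
  have "?S \<subseteq> {..<length a} \<times> {..<length a}" by auto
  then have fin: "finite ?S" by (rule finite_subset) simp
  have split: "{(p, p'). p < p' \<and> p' < length (c # a) \<and> R ((c # a) ! p) ((c # a) ! p')}
    = (\<lambda>(p, p'). (Suc p, Suc p')) ` ?S \<union> (\<lambda>p. (0, Suc p)) ` ?H" (is "?L = ?R")
  proof
    show "?L \<subseteq> ?R"
    proof
      fix e assume "e \<in> ?L"
      then obtain p p' where e: "e = (p, p')" "p < p'" "p' < Suc (length a)" "R ((c # a) ! p) ((c # a) ! p')"
        by auto
      then obtain l where l: "p' = Suc l" by (cases p') auto
      show "e \<in> ?R"
      proof (cases p)
        case 0
        with e l have "l \<in> ?H" "e = (0, Suc l)" by auto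
        then show ?thesis by blast
      next
        case (Suc m)
        with e l have "(m, l) \<in> ?S" "e = (Suc m, Suc l)" by auto
        then show ?thesis by force
      qed
    qed
    show "?R \<subseteq> ?L" by auto
  qed
  have "card ((\<lambda>(p, p'). (Suc p, Suc p')) ` ?S \<union> (\<lambda>p. (0, Suc p)) ` ?H)
      = card ((\<lambda>(p, p'). (Suc p, Suc p')) ` ?S) + card ((\<lambda>p. (0 :: nat, Suc p)) ` ?H)"
    by (rule card_Un_disjoint) (use fin in auto)
  moreover have "card ((\<lambda>(p, p'). (Suc p, Suc p')) ` ?S) = card ?S"
    by (rule card_image) (auto simp: inj_on_def)
  moreover have "card ((\<lambda>p. (0 :: nat, Suc p)) ` ?H) = length (filter (R c) a)"
    unfolding length_filter_conv_card by (rule card_image) (auto simp: inj_on_def)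
  ultimately show ?thesis by (simp only: split)
qed

lemma length_filter_less_bool: "length (filter ((<) c) a) = of_bool (\<not> c) * ones a"
  by (cases c; induction a) (auto simp: less_bool_def)

lemma length_filter_greater_bool: "length (filter ((>) c) a) = of_bool c * (length a - ones a)"
  by (cases c; induction a) (auto simp: less_bool_def Suc_diff_le ones_le_length)

lemma ascents_simps [simp]:
  "ascents [] = 0" "ascents (c # a) = ascents a + of_bool (\<not> c) * ones a"
  using card_pairs_Cons[of c a "(<)"]
  by (simp_all only: ascents_def length_filter_less_bool) simp

lemma descents_simps [simp]:
  "descents [] = 0" "descents (c # a) = descents a + of_bool c * (length a - ones a)"
  using card_pairs_Cons[of c a "(>)"]
  by (simp_all only: descents_def length_filter_greater_bool) simp

lemma ascents_append: "ascents (a @ b) = ascents a + ascents b + (length a - ones a) * ones b"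
proof (induction a)
  case (Cons c a)
  \<comment> \<open>With the number of zeros as a variable, the truncated subtraction becomes a
    polynomial expression.\<close>
  moreover obtain k where "length a = ones a + k"
    using le_Suc_ex[OF ones_le_length[of a]] by blast
  ultimately show ?case by (simp add: algebra_simps)
qed simp

lemma descents_append: "descents (a @ b) = descents a + descents b + ones a * (length b - ones b)"
proof (induction a)
  case (Cons c a)
  moreover obtain k l where "length a = ones a + k" "length b = ones b + l"
    using le_Suc_ex[OF ones_le_length[of a]] le_Suc_ex[OF ones_le_length[of b]] by blast
  ultimately show ?case by (simp add: algebra_simps)
qed simp

text \<open>Reversal and complementation each exchange ascents with descents, so together they
  preserve both. Hence the two halves of the capped factors have equally many descents.\<close>

lemma descents_rev_map_Not: "descents (rev (map Not a)) = descents a"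
  by (induction a) (auto simp: descents_append ones_map_Not ones_le_length)

text \<open>Any two positions with different bits form either an ascent or a descent.\<close>

lemma ascents_plus_descents: "ascents a + descents a = ones a * (length a - ones a)"
proof (induction a)
  case (Cons c a)
  moreover obtain k where "length a = ones a + k"
    using le_Suc_ex[OF ones_le_length[of a]] by blast
  ultimately show ?case by (simp add: algebra_simps)
qed simp

text \<open>The inversion generating function of the quantum binomial in its bar-symmetric
  normalization, by induction on the first bit. An integer \<open>m\<close> lets the induction pass
  to \<open>m - 1\<close> without a lower bound, since both sides vanish for negative
  \<open>m\<close>.\<close>

lemma sum_descents_minus_ascents:
  "(\<Sum>a | length a = n. if int (ones a) = m then q powi (int (descents a) - int (ascents a)) else 0)
    = qbinom n m"
proof (induction n arbitrary: m)
  case 0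
  then show ?case unfolding sum_bit_strings_0 by (auto simp: qbinom_def)
next
  case (Suc n)
  have "(\<Sum>a | length a = n. if int (ones (True # a)) = m
       then q powi (int (descents (True # a)) - int (ascents (True # a))) else 0)
    = q powi (int n + 1 - m) * qbinom n (m - 1)"
    unfolding Suc[symmetric] sum_distrib_left
    by (intro sum.cong refl)
      (auto simp: ones_le_length of_nat_diff simp flip: power_int_add intro!: arg_cong[of _ _ "power_int q"])
  moreover have "(\<Sum>a | length a = n. if int (ones (False # a)) = m
       then q powi (int (descents (False # a)) - int (ascents (False # a))) else 0)
    = q powi (- m) * qbinom n m"
    unfolding Suc[symmetric] sum_distrib_left
    by (intro sum.cong refl)
      (auto simp flip: power_int_add intro!: arg_cong[of _ _ "power_int q"])
  ultimately show ?case
    by (simp only: sum_bit_strings_Suc qbinom_Suc)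
qed

text \<open>Twice the descents is the balanced weight plus the total number of ascents and descents,
  and that total depends only on the number of ones.\<close>

lemma sum_descents:
  "(\<Sum>a | length a = n. if ones a = m then q powi (2 * int (descents a)) else 0)
    = q powi (int m * (int n - int m)) * qbinom n (int m)"
  unfolding sum_descents_minus_ascents[symmetric] sum_distrib_left
proof (intro sum.cong refl)
  fix a :: "bool list" assume "a \<in> {a. length a = n}"
  then have "int (ascents a) + int (descents a) = int (ones a) * (int n - int (ones a))"
    using arg_cong[OF ascents_plus_descents[of a], of int] ones_le_length[of a]
    by (simp add: of_nat_diff)
  then show "(if ones a = m then q powi (2 * int (descents a)) else 0)
      = q powi (int m * (int n - int m))
        * (if int (ones a) = int m then q powi (int (descents a) - int (ascents a)) else 0)"
    by (auto simp flip: power_int_add intro!: arg_cong[of _ _ "power_int q"])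
qed

section \<open>The 3j-symbol as a sum\<close>

lemma cap_at_append:
  assumes "length b = p"
  shows "cap_at p w (b @ c) = w (b @ [False, True] @ c) - inverse q * w (b @ [True, False] @ c)"
  using assms by (simp add: cap_at_def UNIV_bool)

text \<open>A cap forces opposite bits on its two factors and costs \<open>- inverse q\<close>
  exactly when the one is on the left, hence the exponent \<open>ones u\<close>. The induction needs
  arbitrary \<open>w\<close> because the recursion first applies the innermost cap to
  \<open>w\<close>.\<close>

lemma nested_caps_append:
  assumes "length b = x"
  shows "nested_caps x z w (b @ c)
    = (\<Sum>u | length u = z. (- inverse q) ^ ones u * w (b @ u @ rev (map Not u) @ c))"
proof (induction z arbitrary: w)
  case (Suc z)
  have "nested_caps x (Suc z) w (b @ c) = (\<Sum>u | length u = z. (- inverse q) ^ ones u *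
      cap_at (x + z) w ((b @ u) @ rev (map Not u) @ c))"
    by (simp add: Suc)
  also have "\<dots> = (\<Sum>u | length u = z. (- inverse q) ^ ones u *
      (w (b @ u @ [False, True] @ rev (map Not u) @ c)
       - inverse q * w (b @ u @ [True, False] @ rev (map Not u) @ c)))"
  proof (intro sum.cong refl)
    fix u :: "bool list" assume "u \<in> {u. length u = z}"
    then have "length (b @ u) = x + z" using assms by simp
    from cap_at_append[OF this] show "(- inverse q) ^ ones u * cap_at (x + z) w ((b @ u) @ rev (map Not u) @ c) =
       (- inverse q) ^ ones u *
      (w (b @ u @ [False, True] @ rev (map Not u) @ c)
       - inverse q * w (b @ u @ [True, False] @ rev (map Not u) @ c))"
      by (simp only: append_assoc)
  qed
  also have "\<dots> = (\<Sum>u | length u = Suc z. (- inverse q) ^ ones u * w (b @ u @ rev (map Not u) @ c))"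
    \<comment> \<open>The innermost cap sits between \<open>u\<close> and its mirror image: it
      appends a bit to \<open>u\<close> and prepends the opposite bit to
      \<open>rev (map Not u)\<close>.\<close>
    unfolding sum_bit_strings_snoc
    by (intro sum.cong refl) (simp add: algebra_simps)
  finally show ?case .
qed simp

lemma incl2_basis_tensor:
  assumes "r \<le> i" "s \<le> j"
  shows "incl2 i j (basis_tensor r s) a = incl_basis i r (take i a) * incl_basis j s (drop i a)"
proof -
  have "incl2 i j (basis_tensor r s) a
    = (\<Sum>m\<le>i. if m = r then (\<Sum>m'\<le>j. if m' = s then
        incl_basis i m (take i a) * incl_basis j m' (drop i a) else 0) else 0)"
    unfolding incl2_def
  proof (intro sum.cong refl)
    fix m
    have "(\<Sum>m'\<le>j. basis_tensor r s (m, m') * (incl_basis i m (take i a) * incl_basis j m' (drop i a)))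
      = (\<Sum>m'\<le>j. if m' = s then
          (if m = r then incl_basis i m (take i a) * incl_basis j m' (drop i a) else 0) else 0)"
      by (intro sum.cong refl) (simp add: basis_tensor_def basis_vec_def)
    then show "(\<Sum>m'\<le>j. basis_tensor r s (m, m') * (incl_basis i m (take i a) * incl_basis j m' (drop i a)))
      = (if m = r then (\<Sum>m'\<le>j. if m' = s then
          incl_basis i m (take i a) * incl_basis j m' (drop i a) else 0) else 0)"
      by simp
  qed
  also have "\<dots> = incl_basis i r (take i a) * incl_basis j s (drop i a)"
    using assms by simp
  finally show ?thesis .
qed

lemma dual_coord_proj:
  assumes "t \<le> k"
  shows "dual_coord k (proj k w) t
    = (\<Sum>a | length a = k. if ones a = t then w a * q powi (- int (ascents a)) else 0)"
  unfolding dual_coord_def proj_def sum_distrib_left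
  using assms qbinom_nonzero[OF assms]
  by (intro sum.cong refl) (auto simp: dual_vec_def basis_vec_def)

text \<open>The coordinates of \<open>v_t\<close> are 0 and 1, hence fixed by \<open>bar\<close>.
  The remaining power of q is the whole difference between the 3j-symbol and a dual
  coordinate.\<close>

lemma evaluation_form_basis_vec:
  assumes "t \<le> k"
  shows "evaluation_form k (basis_vec t) w = q ^ (t * (k - t)) * dual_coord k w t"
proof -
  have "evaluation_form k (basis_vec t) w
     = (\<Sum>m\<le>k. if m = t then q ^ (t * (k - t)) * dual_coord k w t else 0)"
    unfolding evaluation_form_def by (intro sum.cong refl) (auto simp: basis_vec_def)
  with assms show ?thesis by simp
qed

lemma sum_group_by_ones:
  fixes f :: "bool list \<Rightarrow> 'a :: comm_monoid_add"
  shows "(\<Sum>u | length u = n. f u) = (\<Sum>a=0..n. \<Sum>u | length u = n. if ones u = a then f u else 0)"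
proof -
  have "(\<Sum>u | length u = n. f u) = (\<Sum>u | length u = n. \<Sum>a=0..n. if ones u = a then f u else 0)"
    using ones_le_length by (intro sum.cong refl) (auto simp: sum.delta)
  then show ?thesis by (simp only: sum.swap[of _ "{0..n}"])
qed

text \<open>The contribution of a single state: \<open>b\<close> and \<open>c\<close> are the bits
  on the x and y uncapped factors, \<open>u\<close> those on the left ends of the caps. The caps
  give the power of \<open>- inverse q\<close>, the two inclusions the descents, the projection the
  ascents. The factor of the evaluation form is not included.\<close>

definition state_weight :: "nat \<Rightarrow> nat \<Rightarrow> nat \<Rightarrow> nat \<Rightarrow> bool list \<Rightarrow> bool list \<Rightarrow> bool list \<Rightarrow> ratfun" where
  "state_weight r s t z b c u =
    (if ones b + ones c = t \<and> ones b + ones u = r \<and> (z - ones u) + ones c = s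
     then (- inverse q) ^ ones u * q powi (int (descents (b @ u)) + int (descents (rev (map Not u) @ c)) - int (ascents (b @ c)))
     else 0)"

lemma dual_coord_intertwiner:
  assumes r: "r \<le> x + z" and s: "s \<le> z + y" and t: "t \<le> x + y"
  shows "dual_coord (x + y) (intertwiner (x + z) (z + y) (x + y) (basis_tensor r s)) t
    = (\<Sum>b | length b = x. \<Sum>c | length c = y. \<Sum>u | length u = z. state_weight r s t z b c u)"
  unfolding intertwiner_def dual_coord_proj[OF t] sum_bit_strings_append
proof (intro sum.cong refl)
  fix b c :: "bool list" assume "b \<in> {b. length b = x}" "c \<in> {c. length c = y}"
  then have b: "length b = x" and c: "length c = y" by auto
  have div: "(x + z + (x + y) - (z + y)) div 2 = x" "(x + z + (z + y) - (x + y)) div 2 = z" by auto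
  have incl: "incl2 (x + z) (z + y) (basis_tensor r s) (b @ u @ rev (map Not u) @ c)
    = (if ones b + ones u = r \<and> (z - ones u) + ones c = s
       then q powi (int (descents (b @ u)) + int (descents (rev (map Not u) @ c))) else 0)"
    if "length u = z" for u
    using that b c
    by (simp add: incl2_basis_tensor[OF r s] incl_basis_def ones_map_Not power_int_add flip: power_int_of_nat)
  show "(if ones (b @ c) = t then Phi (x + z) (z + y) (x + y) (incl2 (x + z) (z + y) (basis_tensor r s)) (b @ c)
         * q powi (- int (ascents (b @ c))) else 0)
    = (\<Sum>u | length u = z. state_weight r s t z b c u)"
  proof (cases "ones b + ones c = t")
    case True
    have "Phi (x + z) (z + y) (x + y) (incl2 (x + z) (z + y) (basis_tensor r s)) (b @ c)
         * q powi (- int (ascents (b @ c))) = (\<Sum>u | length u = z. state_weight r s t z b c u)"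
      unfolding Phi_def div nested_caps_append[OF b] sum_distrib_right
    proof (intro sum.cong refl)
      fix u :: "bool list" assume "u \<in> {u. length u = z}"
      then have "length u = z" by simp
      then show "(- inverse q) ^ ones u * incl2 (x + z) (z + y) (basis_tensor r s) (b @ u @ rev (map Not u) @ c)
          * q powi (- int (ascents (b @ c))) = state_weight r s t z b c u"
        unfolding incl[OF \<open>length u = z\<close>] using True
        by (simp add: state_weight_def power_int_add power_int_diff power_int_minus divide_simps)
    qed
    with True show ?thesis by simp
  next
    case False
    then show ?thesis by (simp add: state_weight_def)
  qed
qed

text \<open>Ascents and descents across the seam of a concatenation depend only on numbers of ones.
  Together with \<open>t * (k - t)\<close>, where k = x + y, these cross terms are
  \<open>exponent\<close> without its summand \<open>a * (z - a)\<close>; what is left are the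
  intrinsic weights of \<open>b\<close>, \<open>c\<close> and \<open>u\<close>.\<close>

lemma state_weight_eq:
  assumes t: "t + z = r + s" and b: "length b = x" and c: "length c = y" and u: "length u = z"
  defines "a \<equiv> ones u"
  shows "q ^ (t * (x + y - t)) * state_weight r s t z b c u
    = (-1) ^ a * q powi (- int a) * q powi (exponent (int x) (int y) (int z) (int (z + y)) (int r) (int s) (int a) - int a * (int z - int a))
      * ((if int (ones b) = int r - int a then q powi (int (descents b) - int (ascents b)) else 0)
      * ((if int (ones c) = int s - int z + int a then q powi (int (descents c) - int (ascents c)) else 0)
      * q powi (2 * int (descents u))))"
proof -
  have le: "ones b \<le> x" "ones c \<le> y" "a \<le> z"
    using b c u ones_le_length a_def by auto
  show ?thesis
  proof (cases "ones b + ones c = t \<and> ones b + ones u = r \<and> (z - ones u) + ones c = s")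
    case True
    define m n where "m = ones b" and "n = ones c"
    have rs: "int r = int m + int a" "int s = int z - int a + int n"
      using True le by (auto simp: m_def n_def a_def)
    have tk: "t = m + n" "t \<le> x + y" using True le by (auto simp: m_def n_def)
    have des: "int (descents (b @ u)) = int (descents b) + int (descents u) + int m * (int z - int a)"
      using le u by (simp add: descents_append m_def a_def of_nat_diff)
    have des': "int (descents (rev (map Not u) @ c)) = int (descents u) + int (descents c) + (int z - int a) * (int y - int n)"
      using le u c by (simp add: descents_append descents_rev_map_Not ones_map_Not a_def n_def of_nat_diff)
    have asc: "int (ascents (b @ c)) = int (ascents b) + int (ascents c) + (int x - int m) * int n"
      using le b by (simp add: ascents_append m_def n_def of_nat_diff)
    have "int (t * (x + y - t)) + (int (descents (b @ u)) + int (descents (rev (map Not u) @ c)) - int (ascents (b @ c)))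
      = exponent (int x) (int y) (int z) (int (z + y)) (int r) (int s) (int a) - int a * (int z - int a)
        + (int (descents b) - int (ascents b)) + (int (descents c) - int (ascents c)) + 2 * int (descents u)"
      unfolding des des' asc exponent_def rs of_nat_mult of_nat_diff[OF tk(2)] unfolding tk
      by (simp add: algebra_simps)
    then have pow: "q ^ (t * (x + y - t)) * q powi (int (descents (b @ u)) + int (descents (rev (map Not u) @ c)) - int (ascents (b @ c)))
      = q powi (exponent (int x) (int y) (int z) (int (z + y)) (int r) (int s) (int a) - int a * (int z - int a))
        * (q powi (int (descents b) - int (ascents b)) * (q powi (int (descents c) - int (ascents c)) * q powi (2 * int (descents u))))"
      by (simp only: power_int_of_nat[symmetric] power_int_add[symmetric] q_nonzero simp_thms mult.assoc[symmetric] add.assoc[symmetric])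
    have sgn: "(- inverse q) ^ a = (-1) ^ a * q powi (- int a)"
      by (simp add: power_minus[of "inverse q"] power_int_minus power_inverse)
    have "int (ones b) = int r - int a" "int (ones c) = int s - int z + int a"
      using rs by (auto simp: m_def n_def)
    moreover have "state_weight r s t z b c u = (- inverse q) ^ a
        * q powi (int (descents (b @ u)) + int (descents (rev (map Not u) @ c)) - int (ascents (b @ c)))"
      using True by (simp only: state_weight_def a_def simp_thms if_True)
    ultimately show ?thesis
      using arg_cong[OF pow, of "(*) ((- inverse q) ^ a)"]
      by (simp only: mult.left_commute[of "q ^ (t * (x + y - t))"] sgn simp_thms if_True mult.assoc)
  next
    case False
    \<comment> \<open>The right-hand side tests only two of the three counting conditions; the third
      follows from them by \<open>t + z = r + s\<close>.\<close>
    then have "\<not> (int (ones b) = int r - int a \<and> int (ones c) = int s - int z + int a)"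
      using t le by (auto simp: a_def)
    with False show ?thesis by (auto simp: state_weight_def)
  qed
qed

lemma threej_eq_dual_coord:
  assumes "t \<le> k"
  shows "threej i j k r s t = q ^ (t * (k - t)) * dual_coord k (intertwiner i j k (basis_tensor r s)) t"
  by (simp add: threej_def evaluation_form_basis_vec[OF assms])

text \<open>Weight conservation: the three counting conditions of a state add up to
  \<open>t + z = r + s\<close>, so every weight is zero otherwise.\<close>

lemma threej_eq_0:
  assumes "r \<le> x + z" "s \<le> z + y" "t \<le> x + y" "t + z \<noteq> r + s"
  shows "threej (x + z) (z + y) (x + y) r s t = 0"
proof -
  have "state_weight r s t z b c u = 0" if "length u = z" for b c u
    using assms(4) ones_le_length[of u] that by (auto simp: state_weight_def)
  then show ?thesis
    unfolding threej_eq_dual_coord[OF assms(3)] dual_coord_intertwiner[OF assms(1-3)] by simp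
qed

lemma threej_eq_sum:
  assumes "r \<le> x + z" "s \<le> z + y" "t \<le> x + y" and t: "t + z = r + s"
  shows "threej (x + z) (z + y) (x + y) r s t
    = (\<Sum>a=0..z. (-1) ^ a * q powi (- int a) * q powi exponent (int x) (int y) (int z) (int (z + y)) (int r) (int s) (int a)
         * qbinom z (int a) * qbinom x (int r - int a) * qbinom y (int (z + y) - int s - int a))"
proof -
  let ?e = "\<lambda>a. exponent (int x) (int y) (int z) (int (z + y)) (int r) (int s) (int a)"
  let ?P = "\<lambda>m b. if int (ones b) = m then q powi (int (descents b) - int (ascents b)) else 0"
  let ?w = "\<lambda>a. (-1) ^ a * q powi (- int a) * q powi (?e a - int a * (int z - int a))"
  let ?d = "\<lambda>u :: bool list. q powi (2 * int (descents u))"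
  have factor: "(\<Sum>b\<in>B. \<Sum>c\<in>C. w * (f b * (g c * d))) = w * (sum f B * (sum g C * d))"
    for f g :: "bool list \<Rightarrow> ratfun" and w d B C
    unfolding sum_distrib_right[of f] unfolding sum_distrib_right[of g] sum_distrib_left ..
  \<comment> \<open>The string \<open>c\<close> has \<open>s - z + a\<close> ones, while the formula
    counts its zeros, of which there are \<open>y - (s - z + a) = j - s - a\<close>.\<close>
  have y: "qbinom y (int s - int z + int a) = qbinom y (int (z + y) - int s - int a)" for a
    using qbinom_symmetric[of y "int s - int z + int a"] by (simp add: algebra_simps)
  have "threej (x + z) (z + y) (x + y) r s t
    = (\<Sum>b | length b = x. \<Sum>c | length c = y. \<Sum>u | length u = z. q ^ (t * (x + y - t)) * state_weight r s t z b c u)"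
    unfolding threej_eq_dual_coord[OF assms(3)] dual_coord_intertwiner[OF assms(1-3)] sum_distrib_left ..
  also have "\<dots> = (\<Sum>b | length b = x. \<Sum>c | length c = y. \<Sum>u | length u = z.
      ?w (ones u) * (?P (int r - int (ones u)) b * (?P (int s - int z + int (ones u)) c * ?d u)))"
    using t by (intro sum.cong refl state_weight_eq) auto
  \<comment> \<open>The factors for \<open>b\<close> and \<open>c\<close> involve \<open>u\<close>
    only through \<open>ones u\<close>. Once \<open>u\<close> is the outermost variable, the two
    inner sums separate.\<close>
  also have "\<dots> = (\<Sum>b | length b = x. \<Sum>u | length u = z. \<Sum>c | length c = y.
      ?w (ones u) * (?P (int r - int (ones u)) b * (?P (int s - int z + int (ones u)) c * ?d u)))"
    by (intro sum.cong refl sum.swap)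
  also have "\<dots> = (\<Sum>u | length u = z. \<Sum>b | length b = x. \<Sum>c | length c = y.
      ?w (ones u) * (?P (int r - int (ones u)) b * (?P (int s - int z + int (ones u)) c * ?d u)))"
    by (rule sum.swap)
  also have "\<dots> = (\<Sum>u | length u = z. ?w (ones u) *
      (qbinom x (int r - int (ones u)) * (qbinom y (int (z + y) - int s - int (ones u)) * ?d u)))"
    unfolding factor sum_descents_minus_ascents y ..
  also have "\<dots> = (\<Sum>a=0..z. ?w a *
      (qbinom x (int r - int a) * (qbinom y (int (z + y) - int s - int a)
        * (\<Sum>u | length u = z. if ones u = a then ?d u else 0))))"
    unfolding sum_distrib_left
    by (rule trans[OF sum_group_by_ones]) (intro sum.cong refl, auto)
  also have "\<dots> = (\<Sum>a=0..z. (-1) ^ a * q powi (- int a) * q powi ?e a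
         * qbinom z (int a) * qbinom x (int r - int a) * qbinom y (int (z + y) - int s - int a))"
    unfolding sum_descents
  proof (intro sum.cong refl)
    fix a
    \<comment> \<open>The sum over \<open>u\<close> returns the power that was held back, and this
      completes \<open>exponent\<close>.\<close>
    have "q powi ?e a = q powi (?e a - int a * (int z - int a)) * q powi (int a * (int z - int a))"
      by (simp flip: power_int_add)
    then show "?w a * (qbinom x (int r - int a) * (qbinom y (int (z + y) - int s - int a)
        * (q powi (int a * (int z - int a)) * qbinom z (int a))))
      = (-1) ^ a * q powi (- int a) * q powi ?e a
         * qbinom z (int a) * qbinom x (int r - int a) * qbinom y (int (z + y) - int s - int a)"
      by (simp only: mult_ac)
  qed
  finally show ?thesis .
qed

section \<open>Specialization\<close>

text \<open>Regularity and value are carried together: at a pole \<open>specialize\<close> returns 0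
  and is not multiplicative, whereas this relation is closed under the field operations, with
  nonzero value required for inverses.\<close>

definition specializes :: "complex \<Rightarrow> ratfun \<Rightarrow> complex \<Rightarrow> bool" where
  "specializes c f v \<longleftrightarrow> regular_at c f \<and> specialize c f = v"

lemma specializes_Fract:
  "poly b c \<noteq> 0 \<Longrightarrow> specializes c (Fract a b) (poly a c / poly b c)"
  by (simp add: specializes_def regular_at_Fract specialize_Fract)

lemma specializesE:
  assumes "specializes c f v"
  obtains a b where "f = Fract a b" "poly b c \<noteq> 0" "v = poly a c / poly b c"
proof
  show "f = Fract (fst (quot_of_fract f)) (snd (quot_of_fract f))"
    using quot_to_fract_quot_of_fract[of f] by (simp add: quot_to_fract_def case_prod_beta)
qed (use assms in \<open>auto simp: specializes_def regular_at_def specialize_def\<close>)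

lemma specializes_to_fract: "specializes c (to_fract a) (poly a c)"
  using specializes_Fract[of 1 c a] by (simp add: to_fract_def)

lemma specializes_0: "specializes c 0 0" and specializes_1: "specializes c 1 1"
  using specializes_to_fract[of c 0] specializes_to_fract[of c 1] by simp_all

lemma specializes_q: "specializes c q c"
  using specializes_to_fract[of c "[:0, 1:]"] by (simp add: q_def)

lemma specializes_add:
  assumes "specializes c f v" "specializes c g w"
  shows "specializes c (f + g) (v + w)"
proof -
  obtain a b where f: "f = Fract a b" "poly b c \<noteq> 0" "v = poly a c / poly b c"
    using assms(1) by (rule specializesE)
  obtain d e where g: "g = Fract d e" "poly e c \<noteq> 0" "w = poly d c / poly e c"
    using assms(2) by (rule specializesE)
  have "b \<noteq> 0" "e \<noteq> 0" using f g by auto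
  then have "f + g = Fract (a * e + d * b) (b * e)" "v + w = poly (a * e + d * b) c / poly (b * e) c"
    using f g by (simp_all add: add_frac_eq)
  then show ?thesis
    using f g specializes_Fract[of "b * e" c "a * e + d * b"] by simp
qed

lemma specializes_mult:
  assumes "specializes c f v" "specializes c g w"
  shows "specializes c (f * g) (v * w)"
proof -
  obtain a b where f: "f = Fract a b" "poly b c \<noteq> 0" "v = poly a c / poly b c"
    using assms(1) by (rule specializesE)
  obtain d e where g: "g = Fract d e" "poly e c \<noteq> 0" "w = poly d c / poly e c"
    using assms(2) by (rule specializesE)
  show ?thesis
    using f g specializes_Fract[of "b * e" c "a * d"] by simp
qed

lemma specializes_inverse:
  assumes "specializes c f v" "v \<noteq> 0"
  shows "specializes c (inverse f) (inverse v)"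
proof -
  obtain a b where f: "f = Fract a b" "poly b c \<noteq> 0" "v = poly a c / poly b c"
    using assms(1) by (rule specializesE)
  show ?thesis
    using f assms(2) specializes_Fract[of a c b] by simp
qed

lemma specializes_divide:
  "specializes c f v \<Longrightarrow> specializes c g w \<Longrightarrow> w \<noteq> 0 \<Longrightarrow> specializes c (f / g) (v / w)"
  unfolding divide_inverse by (intro specializes_mult specializes_inverse)

lemma specializes_minus: "specializes c f v \<Longrightarrow> specializes c (- f) (- v)"
  using specializes_mult[OF specializes_to_fract[of c "[:-1:]"]]
  by (metis (no_types, lifting) mult_minus1 one_pCons poly_1 poly_minus minus_pCons minus_zero to_fract_uminus to_fract_1)

lemma specializes_sum:
  "(\<And>m. m \<in> A \<Longrightarrow> specializes c (f m) (v m)) \<Longrightarrow> specializes c (sum f A) (sum v A)"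
  by (induction A rule: infinite_finite_induct) (auto intro: specializes_0 specializes_add)

lemma specializes_prod:
  "(\<And>m. m \<in> A \<Longrightarrow> specializes c (f m) (v m)) \<Longrightarrow> specializes c (prod f A) (prod v A)"
  by (induction A rule: infinite_finite_induct) (auto intro: specializes_1 specializes_mult)

lemma specializes_power: "specializes c f v \<Longrightarrow> specializes c (f ^ n) (v ^ n)"
  by (induction n) (auto intro: specializes_1 specializes_mult)

lemma specializes_power_int:
  "specializes c f v \<Longrightarrow> v \<noteq> 0 \<Longrightarrow> specializes c (f powi n) (v powi n)"
  by (auto simp: power_int_def intro: specializes_power specializes_inverse)

lemma specializes_qint: "specializes 1 (qint m) (of_nat m)"
  using specializes_sum[of "{..<m}" 1 "\<lambda>l. q powi (int m - 1 - 2 * int l)" "\<lambda>l. 1"]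
    specializes_power_int[OF specializes_q, of 1] by (simp add: qint_def)

lemma specializes_qfact: "specializes 1 (qfact m) (fact m)"
proof -
  have "(fact m :: complex) = (\<Prod>l=1..m. of_nat l)"
    by (simp add: fact_prod)
  then show ?thesis
    unfolding qfact_def by (simp only:) (intro specializes_prod specializes_qint)
qed

text \<open>There is no pole at 1 because the quantum factorials in the denominator specialize to
  ordinary factorials, which are nonzero in characteristic 0.\<close>

lemma specializes_qbinom: "specializes 1 (qbinom m l) (of_int (ibinom m l))"
proof (cases "0 \<le> l \<and> l \<le> int m")
  case True
  then have "nat l \<le> m" by auto
  then have "(of_int (ibinom m l) :: complex) = fact m / (fact (nat l) * fact (m - nat l))"
    using True binomial_fact[of "nat l" m] by (simp add: ibinom_def)
  moreover have "specializes 1 (qbinom m l) (fact m / (fact (nat l) * fact (m - nat l)))"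
    using True unfolding qbinom_def
    by (auto intro!: specializes_divide specializes_mult specializes_qfact)
  ultimately show ?thesis by simp
qed (auto simp: qbinom_def ibinom_def specializes_0)

lemma specializes_threej:
  assumes "r \<le> x + z" "s \<le> z + y" "t \<le> x + y" "t + z = r + s"
  shows "specializes 1 (threej (x + z) (z + y) (x + y) r s t)
    (of_int (\<Sum>a=0..z. (-1) ^ a * ibinom z (int a) * ibinom x (int r - int a)
                      * ibinom y (int (z + y) - int s - int a)))"
proof -
  have "specializes 1 (q powi n) 1" for n
    using specializes_power_int[OF specializes_q, of 1] by simp
  moreover have "specializes 1 ((-1) ^ n) ((-1) ^ n)" for n
    by (intro specializes_power specializes_minus specializes_1)
  ultimately have "specializes 1 (threej (x + z) (z + y) (x + y) r s t)
    (\<Sum>a=0..z. (-1) ^ a * 1 * 1 * of_int (ibinom z (int a)) * of_int (ibinom x (int r - int a))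
                      * of_int (ibinom y (int (z + y) - int s - int a)))"
    unfolding threej_eq_sum[OF assms]
    by (intro specializes_sum specializes_mult specializes_qbinom)
  then show ?thesis by simp
qed

section \<open>The line arrangement\<close>

text \<open>
  In boundary order the marked points form blocks of sizes \<open>x\<close>, \<open>2 * z\<close>, \<open>2 * y\<close> and \<open>x\<close>: the middle
  two are each matched symmetrically about a corner of the triangle, and the outer two with each other.
\<close>

definition partner :: "nat \<Rightarrow> nat \<Rightarrow> nat \<Rightarrow> nat \<Rightarrow> nat" where
  "partner x y z p =
    (if p < x then 2 * (x + y + z) - 1 - p
     else if p < x + 2 * z then 2 * x + 2 * z - 1 - p
     else if p < x + 2 * z + 2 * y then 2 * x + 4 * z + 2 * y - 1 - p
     else 2 * (x + y + z) - 1 - p)"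

text \<open>The smaller end point of each arc, so that an orientation can be recorded by the set of
  reference points that are sources. Leaving a reference point means going from i to j, from i to k
  and from j to k on the three blocks, in the order of the union.\<close>

definition reference_points :: "nat \<Rightarrow> nat \<Rightarrow> nat \<Rightarrow> nat set" where
  "reference_points x y z = {x..<x + z} \<union> ({..<x} \<union> {x + 2 * z..<x + 2 * z + y})"

definition standard_arcs :: "nat \<Rightarrow> nat \<Rightarrow> nat \<Rightarrow> nat set set" where
  "standard_arcs x y z = (\<lambda>p. {p, partner x y z p}) ` reference_points x y z"

lemma partner_less: "p < 2 * (x + y + z) \<Longrightarrow> partner x y z p < 2 * (x + y + z)"
  by (auto simp: partner_def)

lemma partner_partner: "p < 2 * (x + y + z) \<Longrightarrow> partner x y z (partner x y z p) = p"
  by (auto simp: partner_def)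

lemma reference_points_less: "p \<in> reference_points x y z \<Longrightarrow> p < 2 * (x + y + z)"
  by (auto simp: reference_points_def)

lemma partner_in_reference_points_iff:
  "p < 2 * (x + y + z) \<Longrightarrow> partner x y z p \<in> reference_points x y z \<longleftrightarrow> p \<notin> reference_points x y z"
  by (auto simp: partner_def reference_points_def split: if_splits)

lemma side_of_partner:
  "p < 2 * (x + y + z) \<Longrightarrow> side_of (x + z) (z + y) (partner x y z p) \<noteq> side_of (x + z) (z + y) p"
  by (auto simp: partner_def side_of_def split: if_splits)

text \<open>Arcs of one kind are nested because the sum of their end points is constant. The arcs
  about the two corners span disjoint intervals, both inside all the outer arcs.\<close>

lemma partner_noncrossing:
  "a < b \<Longrightarrow> b < partner x y z a \<Longrightarrow> partner x y z a < partner x y z b \<Longrightarrow> partner x y z b < 2 * (x + y + z)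
    \<Longrightarrow> False"
  by (auto simp: partner_def split: if_splits)

lemma standard_arcs_iff:
  "{a, b} \<in> standard_arcs x y z \<longleftrightarrow> a < 2 * (x + y + z) \<and> b = partner x y z a"
proof
  assume "{a, b} \<in> standard_arcs x y z"
  then show "a < 2 * (x + y + z) \<and> b = partner x y z a"
    using partner_less partner_partner reference_points_less
    unfolding standard_arcs_def doubleton_eq_iff image_iff by metis
next
  assume "a < 2 * (x + y + z) \<and> b = partner x y z a"
  then have a: "a < 2 * (x + y + z)" and b: "b = partner x y z a" by auto
  show "{a, b} \<in> standard_arcs x y z"
  proof (cases "a \<in> reference_points x y z")
    case True
    then show ?thesis by (auto simp: standard_arcs_def b)
  next
    case False
    then have "b \<in> reference_points x y z"
      using partner_in_reference_points_iff[OF a] b by simp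
    moreover have "{a, b} = {b, partner x y z b}"
      using partner_partner[OF a] b by auto
    ultimately show ?thesis by (auto simp: standard_arcs_def)
  qed
qed

lemma line_arrangement_standard_arcs:
  "line_arrangement (x + z) (z + y) (x + y) (standard_arcs x y z)"
proof -
  have n: "x + z + (z + y) + (x + y) = 2 * (x + y + z)" by simp
  have "\<exists>p p'. \<alpha> = {p, p'} \<and> p < 2 * (x + y + z) \<and> p' < 2 * (x + y + z) \<and>
      side_of (x + z) (z + y) p \<noteq> side_of (x + z) (z + y) p'" if \<alpha>: "\<alpha> \<in> standard_arcs x y z" for \<alpha>
  proof -
    obtain p where "\<alpha> = {p, partner x y z p}" "p < 2 * (x + y + z)"
      using \<alpha> reference_points_less by (auto simp: standard_arcs_def)
    then show ?thesis using partner_less[of p x y z] side_of_partner[of p x y z] by blast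
  qed
  then have 1: "\<forall>\<alpha>\<in>standard_arcs x y z. \<exists>p p'. \<alpha> = {p, p'} \<and> p < 2 * (x + y + z) \<and> p' < 2 * (x + y + z) \<and>
      side_of (x + z) (z + y) p \<noteq> side_of (x + z) (z + y) p'" by (rule ballI)
  have "\<exists>!\<alpha>. \<alpha> \<in> standard_arcs x y z \<and> p \<in> \<alpha>" if p: "p < 2 * (x + y + z)" for p
  proof
    show "{p, partner x y z p} \<in> standard_arcs x y z \<and> p \<in> {p, partner x y z p}"
      using p by (simp add: standard_arcs_iff)
    fix \<alpha> assume \<alpha>: "\<alpha> \<in> standard_arcs x y z \<and> p \<in> \<alpha>"
    then obtain p' where "\<alpha> = {p', partner x y z p'}" "p' < 2 * (x + y + z)"
      using reference_points_less by (auto simp: standard_arcs_def)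
    with \<alpha> show "\<alpha> = {p, partner x y z p}"
      using partner_partner[of p' x y z] by auto
  qed
  then have 2: "\<forall>p<2 * (x + y + z). \<exists>!\<alpha>. \<alpha> \<in> standard_arcs x y z \<and> p \<in> \<alpha>" by simp
  have 3: "\<not> ({a, c} \<in> standard_arcs x y z \<and> {b, d} \<in> standard_arcs x y z)"
    if "a < b" "b < c" "c < d" for a b c d
    using that partner_noncrossing[of a b x y z] partner_less[of b x y z] by (auto simp: standard_arcs_iff)
  show ?thesis
    unfolding line_arrangement_def n using 3 by (intro conjI 1 2 allI impI) auto
qed

section \<open>Uniqueness of the line arrangement\<close>

text \<open>Applied to a matching \<open>f\<close> that exchanges two groups of marked points. The
  involution law is required only on them because such an \<open>f\<close> is arbitrary beyond the
  marked points.\<close>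

lemma card_eq_of_involution:
  assumes "finite X" "finite Y"
    and "\<And>p. p \<in> X \<Longrightarrow> f p \<in> Y" "\<And>p. p \<in> Y \<Longrightarrow> f p \<in> X" "\<And>p. p \<in> X \<union> Y \<Longrightarrow> f (f p) = p"
  shows "card X = card Y"
proof (rule bij_betw_same_card)
  show "bij_betw f X Y"
    by (rule bij_betw_byWitness[of _ f]) (use assms in auto)
qed

text \<open>
  The marked points on a side that lie beyond an arc can only be joined to the points beyond it on
  the other side, so both groups have the same size. This fixes the sum of the end points of an
  arc in terms of its two sides, and then the sizes of the sides fix how many arcs of each
  kind there are.
\<close>

lemma line_arrangement_unique:
  assumes M: "line_arrangement (x + z) (z + y) (x + y) M"
  shows "M = standard_arcs x y z"
proof -
  define i j n where "i = x + z" and "j = z + y" and "n = 2 * (x + y + z)"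
  have n: "x + z + (z + y) + (x + y) = n" by (simp add: n_def)
  note M' = M[unfolded line_arrangement_def n, folded i_def j_def]
  have arc: "\<exists>p p'. \<alpha> = {p, p'} \<and> p < n \<and> p' < n \<and> side_of i j p \<noteq> side_of i j p'" if "\<alpha> \<in> M" for \<alpha>
    using bspec[OF conjunct1[OF M'] that] .
  have ex: "\<exists>!\<alpha>. \<alpha> \<in> M \<and> p \<in> \<alpha>" if "p < n" for p
    using conjunct1[OF conjunct2[OF M']] that by simp
  have cross: False if "a < b" "b < c" "c < d" "{a, c} \<in> M" "{b, d} \<in> M" for a b c d
    using conjunct2[OF conjunct2[OF M']] that by blast
  have "\<exists>p'. {p, p'} \<in> M" if p: "p < n" for p
  proof -
    obtain \<alpha> where "\<alpha> \<in> M" "p \<in> \<alpha>" using ex[OF p] by blast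
    moreover obtain u v where "\<alpha> = {u, v}" using arc[OF \<open>\<alpha> \<in> M\<close>] by blast
    ultimately show ?thesis by (auto simp: insert_commute)
  qed
  \<comment> \<open>The matching as a function. Its values at \<open>p >= n\<close> are unspecified,
    which explains the bounds below.\<close>
  then obtain f where f: "\<And>p. p < n \<Longrightarrow> {p, f p} \<in> M" by metis
  have less: "a < n" "b < n" and sides: "side_of i j a \<noteq> side_of i j b" if "{a, b} \<in> M" for a b
    using arc[OF that] by (auto simp: doubleton_eq_iff)
  have f_eq: "b = f a" if ab: "{a, b} \<in> M" for a b
  proof -
    have "{a, b} = {a, f a}" using ex[OF less(1)[OF ab]] ab f[OF less(1)[OF ab]] by blast
    then show ?thesis by (auto simp: doubleton_eq_iff)
  qed
  have f_less: "f p < n" and f_side: "side_of i j p \<noteq> side_of i j (f p)" if "p < n" for p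
    using less(2)[OF f[OF that]] sides[OF f[OF that]] by auto
  have ff: "f (f p) = p" if "p < n" for p
    using f_eq[of "f p" p] f[OF that] by (simp add: insert_commute)
  \<comment> \<open>An arc that starts strictly inside another arc and ends outside would cross it;
    sharing an end point is excluded because \<open>f\<close> is an involution.\<close>
  have f_inside: "p < f b \<and> f b < f p" if "p < b" "b < f p" "p < n" for p b
  proof -
    have b: "b < n" using that f_less[of p] by auto
    have "f b \<noteq> p" "f b \<noteq> f p" using that ff[of b] ff[of p] b by (metis nat_neq_iff)+
    moreover have "\<not> f p < f b" using cross[OF that(1,2) _ f f] that b by blast
    moreover have "\<not> f b < p"
      using cross[OF _ that(1,2), of "f b"] f[OF b] f[OF that(3)] by (auto simp: insert_commute)
    ultimately show ?thesis by linarith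
  qed
  have f_outside: "f b < p \<or> f p < f b" if "b < p \<or> f p < b" "p < f p" "p < n" "b < n" for p b
  proof (rule ccontr)
    assume "\<not> (f b < p \<or> f p < f b)"
    moreover have "f b \<noteq> p" "f b \<noteq> f p" using that ff[of b] ff[of p] by auto
    ultimately have "p < f b" "f b < f p" by auto
    then have "p < f (f b)" "f (f b) < f p" using f_inside[of p "f b"] that by auto
    then show False using that ff[of b] by auto
  qed
  have IJ: "f p = 2 * i - 1 - p" if p: "p < i" "i \<le> f p" "f p < i + j" for p
  proof -
    have pn: "p < n" using p by (simp add: i_def n_def)
    have "card {p<..<i} = card {i..<f p}"
    proof (rule card_eq_of_involution[where f = f])
      fix b assume "b \<in> {p<..<i}"
      then have b: "p < b" "b < i" "b < n" using p by (auto simp: i_def n_def)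
      then show "f b \<in> {i..<f p}"
        using f_inside[of p b] f_side[of b] p pn by (auto simp: side_of_def split: if_splits)
    next
      fix b assume "b \<in> {i..<f p}"
      then have b: "i \<le> b" "b < f p" "b < n" using p f_less[OF pn] by auto
      then show "f b \<in> {p<..<i}"
        using f_inside[of p b] f_side[of b] p pn by (auto simp: side_of_def split: if_splits)
    next
      fix b assume "b \<in> {p<..<i} \<union> {i..<f p}"
      then show "f (f b) = b" using f_less[OF pn] p by (intro ff) (auto simp: i_def n_def)
    qed auto
    then show ?thesis using p by simp
  qed
  have JK: "f p = 2 * (i + j) - 1 - p" if p: "i \<le> p" "p < i + j" "i + j \<le> f p" for p
  proof -
    have pn: "p < n" using p by (simp add: i_def j_def n_def)
    have "card {p<..<i + j} = card {i + j..<f p}"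
    proof (rule card_eq_of_involution[where f = f])
      fix b assume "b \<in> {p<..<i + j}"
      then have b: "p < b" "b < i + j" "b < n" using p by (auto simp: i_def j_def n_def)
      then show "f b \<in> {i + j..<f p}"
        using f_inside[of p b] f_side[of b] p pn by (auto simp: side_of_def split: if_splits)
    next
      fix b assume "b \<in> {i + j..<f p}"
      then have b: "i + j \<le> b" "b < f p" "b < n" using p f_less[OF pn] by auto
      then show "f b \<in> {p<..<i + j}"
        using f_inside[of p b] f_side[of b] p pn by (auto simp: side_of_def split: if_splits)
    next
      fix b assume "b \<in> {p<..<i + j} \<union> {i + j..<f p}"
      then show "f (f b) = b" using f_less[OF pn] p by (intro ff) (auto simp: i_def j_def n_def)
    qed auto
    then show ?thesis using p by simp
  qed
  have IK: "f p = n - 1 - p" if p: "p < i" "i + j \<le> f p" for p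
  proof -
    have pn: "p < n" using p by (simp add: i_def n_def)
    \<comment> \<open>The corner between the i- and the k-side is where the numbering wraps around,
      so the points beyond this arc are those outside the interval from \<open>p\<close> to
      \<open>f p\<close>.\<close>
    have "card {..<p} = card {f p<..<n}"
    proof (rule card_eq_of_involution[where f = f])
      fix b assume "b \<in> {..<p}"
      then show "f b \<in> {f p<..<n}"
        using f_outside[of b p] f_side[of b] f_less[of b] p pn by (auto simp: side_of_def split: if_splits)
    next
      fix b assume "b \<in> {f p<..<n}"
      then show "f b \<in> {..<p}"
        using f_outside[of b p] f_side[of b] p pn by (auto simp: side_of_def split: if_splits)
    next
      fix b assume "b \<in> {..<p} \<union> {f p<..<n}"
      then show "f (f b) = b" using pn by (intro ff) auto
    qed auto
    then show ?thesis using f_less[OF pn] by simp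
  qed
  \<comment> \<open>\<open>A\<close> holds the i-ends of the ij-arcs and \<open>B\<close> the j-ends
    of the jk-arcs. Counting the j-side gives |A| + |B| = j, counting the k-side gives (i - |A|) +
    |B| = k, and so 2 |A| = i + j - k = 2 z.\<close>
  define A B where "A = {p. p < i \<and> f p < i + j}" and "B = {p. i \<le> p \<and> p < i + j \<and> i + j \<le> f p}"
  have fin: "finite A" "finite B" by (auto simp: A_def B_def)
  have in_n: "i + j + (x + y) = n" "i + j \<le> n" by (simp_all add: i_def j_def n_def)
  have "card A = card ({i..<i + j} - B)"
  proof (rule card_eq_of_involution[where f = f])
    fix p assume "p \<in> A"
    then have p: "p < i" "f p < i + j" "p < n" using in_n by (auto simp: A_def)
    then show "f p \<in> {i..<i + j} - B"
      using ff[of p] f_side[of p] by (auto simp: side_of_def B_def split: if_splits)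
  next
    fix p assume "p \<in> {i..<i + j} - B"
    then have p: "i \<le> p" "p < i + j" "f p < i + j" "p < n" using in_n by (auto simp: B_def)
    then show "f p \<in> A"
      using ff[of p] f_side[of p] by (auto simp: side_of_def A_def split: if_splits)
  next
    fix p assume "p \<in> A \<union> ({i..<i + j} - B)"
    then show "f (f p) = p" using in_n by (intro ff) (auto simp: A_def)
  qed (use fin in auto)
  moreover have "card ({i..<i + j} - B) = j - card B"
    using fin by (subst card_Diff_subset) (auto simp: B_def)
  moreover have "card B \<le> j"
  proof -
    have "B \<subseteq> {i..<i + j}" by (auto simp: B_def)
    then show ?thesis using card_mono[of "{i..<i + j}" B] by simp
  qed
  moreover have "card (({..<i} - A) \<union> B) = card {i + j..<n}"
  proof (rule card_eq_of_involution[where f = f])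
    fix p assume "p \<in> ({..<i} - A) \<union> B"
    then show "f p \<in> {i + j..<n}"
      using f_less[of p] in_n by (auto simp: A_def B_def)
  next
    fix p assume "p \<in> {i + j..<n}"
    then show "f p \<in> ({..<i} - A) \<union> B"
      using f_side[of p] ff[of p] by (auto simp: A_def B_def side_of_def split: if_splits)
  next
    fix p assume "p \<in> (({..<i} - A) \<union> B) \<union> {i + j..<n}"
    then show "f (f p) = p" using in_n by (intro ff) (auto simp: B_def)
  qed (use fin in auto)
  moreover have "card (({..<i} - A) \<union> B) = card ({..<i} - A) + card B"
    using fin by (intro card_Un_disjoint) (auto simp: B_def)
  moreover have "card ({..<i} - A) = i - card A"
    using fin by (subst card_Diff_subset) (auto simp: A_def)
  moreover have "card A \<le> i"
  proof -
    have "A \<subseteq> {..<i}" by (auto simp: A_def)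
    then show ?thesis using card_mono[of "{..<i}" A] by simp
  qed
  ultimately have card_A: "card A = z"
    by (auto simp: i_def j_def n_def)
  have "A \<subseteq> {x..<i}"
  proof
    fix p assume p: "p \<in> A"
    then have p': "p < i" "f p < i + j" "p < n" using in_n by (auto simp: A_def)
    have "i \<le> f p" using p' f_side[of p] by (auto simp: side_of_def split: if_splits)
    \<comment> \<open>Points between \<open>p\<close> and the corner lie inside the arc of
      \<open>p\<close>, so \<open>A\<close> is a final segment of the i-side; its size then
      determines it.\<close>
    have "{p..<i} \<subseteq> A"
    proof
      fix b assume b: "b \<in> {p..<i}"
      show "b \<in> A"
      proof (cases "b = p")
        case False
        then have "f b < f p" using b f_inside[of p b] p' \<open>i \<le> f p\<close> by auto
        then show ?thesis using b p' by (auto simp: A_def)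
      qed (use p in simp)
    qed
    then have "i - p \<le> z" using card_mono[OF fin(1), of "{p..<i}"] card_A by simp
    then show "p \<in> {x..<i}" using p' by (auto simp: i_def)
  qed
  then have A: "A = {x..<i}"
    using card_A by (intro card_subset_eq) (auto simp: i_def)
  have I: "f p = partner x y z p" if p: "p < i" for p
  proof (cases "p < x")
    case True
    then have "p \<notin> A" using A by auto
    then have "i + j \<le> f p" using p by (auto simp: A_def)
    then show ?thesis using IK[OF p] True by (auto simp: partner_def n_def)
  next
    case False
    then have "p \<in> A" using A p by auto
    then have "f p < i + j" "i \<le> f p"
      using f_side[of p] in_n p by (auto simp: A_def side_of_def split: if_splits)
    then show ?thesis using IJ[OF p] False p by (auto simp: partner_def i_def)
  qed
  have IJ_J: "f p = partner x y z p" if p: "i \<le> p" "p < i + j" for p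
  proof (cases "p < i + z")
    case True
    have pn: "p < 2 * (x + y + z)" using p in_n by (simp add: n_def)
    have "partner x y z p < i" using True p by (auto simp: partner_def i_def)
    then have "f (partner x y z p) = p" using I partner_partner[OF pn] by simp
    then show ?thesis using ff[of "partner x y z p"] partner_less[OF pn] by (simp add: n_def)
  next
    case False
    have pn: "p < n" using p in_n by simp
    \<comment> \<open>The i-ends of the ij-arcs fill \<open>{x..<i}\<close>, so their j-ends fill
      \<open>{i..<i + z}\<close>, and \<open>p\<close> lies beyond these.\<close>
    have "\<not> f p < i"
    proof
      assume "f p < i"
      moreover have "f p \<in> A" using \<open>f p < i\<close> p ff[OF pn] by (simp add: A_def)
      ultimately have "partner x y z (f p) < i + z" using A by (auto simp: partner_def i_def)
      then show False using I[OF \<open>f p < i\<close>] ff[OF pn] False by simp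
    qed
    then have "i + j \<le> f p" using f_side[OF pn] p by (auto simp: side_of_def split: if_splits)
    then show ?thesis using JK[OF p] p False by (auto simp: partner_def i_def j_def)
  qed
  have f_partner: "f p = partner x y z p" if p: "p < n" for p
  proof (cases "p < i + j")
    case True
    then show ?thesis using I IJ_J by (cases "p < i") auto
  next
    case False
    then have "f p < i + j" using f_side[OF p] by (auto simp: side_of_def split: if_splits)
    then have "partner x y z (f p) = p" using I IJ_J ff[OF p] by (cases "f p < i") auto
    then show ?thesis using partner_partner[of "f p" x y z] f_less[OF p] by (simp add: n_def)
  qed
  show ?thesis
  proof
    show "M \<subseteq> standard_arcs x y z"
    proof
      fix \<alpha> assume \<alpha>: "\<alpha> \<in> M"
      then obtain a b where ab: "\<alpha> = {a, b}" "a < n" using arc by blast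
      then have "b = partner x y z a" using f_eq[of a b] f_partner[of a] \<alpha> by simp
      then show "\<alpha> \<in> standard_arcs x y z" using ab by (simp add: standard_arcs_iff n_def)
    qed
    show "standard_arcs x y z \<subseteq> M"
    proof
      fix \<alpha> assume "\<alpha> \<in> standard_arcs x y z"
      then obtain p where "\<alpha> = {p, partner x y z p}" "p < n"
        using reference_points_less by (auto simp: standard_arcs_def n_def)
      then show "\<alpha> \<in> M" using f[of p] f_partner[of p] by simp
    qed
  qed
qed

section \<open>Orientations\<close>

definition orient :: "nat \<Rightarrow> nat \<Rightarrow> nat \<Rightarrow> nat set \<Rightarrow> (nat \<times> nat) set" where
  "orient x y z S = (\<lambda>p. (p, partner x y z p)) ` S
     \<union> (\<lambda>p. (partner x y z p, p)) ` (reference_points x y z - S)"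

lemma finite_reference_points [simp]: "finite (reference_points x y z)"
  by (simp add: reference_points_def)

lemma partner_not_reference_point:
  "p \<in> reference_points x y z \<Longrightarrow> partner x y z p \<notin> reference_points x y z"
  using partner_in_reference_points_iff reference_points_less by blast

lemma mem_orient_iff:
  assumes "S \<subseteq> reference_points x y z" "p \<in> reference_points x y z"
  shows "(p, u) \<in> orient x y z S \<longleftrightarrow> p \<in> S \<and> u = partner x y z p"
    and "(u, p) \<in> orient x y z S \<longleftrightarrow> p \<notin> S \<and> u = partner x y z p"
  using assms partner_not_reference_point by (auto simp: orient_def)

lemma card_orient:
  assumes S: "S \<subseteq> reference_points x y z"
  shows "card {e \<in> orient x y z S. P e}
    = card {p \<in> S. P (p, partner x y z p)} + card {p \<in> reference_points x y z - S. P (partner x y z p, p)}"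
proof -
  let ?F = "(\<lambda>p. (p, partner x y z p)) ` {p \<in> S. P (p, partner x y z p)}"
  let ?G = "(\<lambda>p. (partner x y z p, p)) ` {p \<in> reference_points x y z - S. P (partner x y z p, p)}"
  have fin: "finite S" using S finite_subset finite_reference_points by blast
  have "{e \<in> orient x y z S. P e} = ?F \<union> ?G"
    by (auto simp: orient_def)
  moreover have "card (?F \<union> ?G) = card ?F + card ?G"
    by (rule card_Un_disjoint) (use fin S partner_not_reference_point in auto)
  moreover have "card ?F = card {p \<in> S. P (p, partner x y z p)}"
    by (rule card_image) (auto simp: inj_on_def)
  moreover have "card ?G = card {p \<in> reference_points x y z - S. P (partner x y z p, p)}"
    by (rule card_image) (auto simp: inj_on_def)
  ultimately show ?thesis by (simp only:)
qed

lemma oriented_arrangement_orient: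
  assumes S: "S \<subseteq> reference_points x y z"
  shows "oriented_arrangement (x + z) (z + y) (x + y) (orient x y z S)"
proof -
  have "(\<lambda>(p, p'). {p, p'}) ` orient x y z S
    = (\<lambda>p. {p, partner x y z p}) ` S \<union> (\<lambda>p. {p, partner x y z p}) ` (reference_points x y z - S)"
    unfolding orient_def image_Un image_image by (simp only: prod.case insert_commute)
  also have "\<dots> = standard_arcs x y z"
    using S by (auto simp: standard_arcs_def)
  finally have arcs: "(\<lambda>(p, p'). {p, p'}) ` orient x y z S = standard_arcs x y z" .
  \<comment> \<open>Pairs with the same two end points are equal or reverse to each other. The
    latter is impossible, since their reference point would be both source and target.\<close>
  have no_rev: False if "(a, b) \<in> orient x y z S" "(b, a) \<in> orient x y z S" for a b
  proof -
    have "a \<in> reference_points x y z \<or> b \<in> reference_points x y z"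
      using that(1) S by (auto simp: orient_def)
    then show False
      using that mem_orient_iff[OF S, of a b] mem_orient_iff[OF S, of b a] by metis
  qed
  have "inj_on (\<lambda>(p, p'). {p, p'}) (orient x y z S)"
  proof (rule inj_onI)
    fix e e' assume e: "e \<in> orient x y z S" "e' \<in> orient x y z S"
      and eq: "(case e of (p, p') \<Rightarrow> {p, p'}) = (case e' of (p, p') \<Rightarrow> {p, p'})"
    obtain a b where ab: "e = (a, b)" by (cases e)
    then have "e' = (a, b) \<or> e' = (b, a)" using eq by (cases e') (auto simp: doubleton_eq_iff)
    then show "e = e'" using no_rev e ab by auto
  qed
  then show ?thesis
    using line_arrangement_standard_arcs by (simp add: oriented_arrangement_def arcs)
qed

text \<open>Surjectivity rests on uniqueness of the line arrangement: the arcs below any oriented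
  arrangement are the standard ones, and the inverse map reads off which reference points are
  sources.\<close>

lemma bij_betw_orient:
  "bij_betw (orient x y z) (Pow (reference_points x y z))
     {L. oriented_arrangement (x + z) (z + y) (x + y) L}"
proof (rule bij_betw_byWitness[where f' = "\<lambda>L. {p \<in> reference_points x y z. (p, partner x y z p) \<in> L}"])
  show "\<forall>S\<in>Pow (reference_points x y z).
      {p \<in> reference_points x y z. (p, partner x y z p) \<in> orient x y z S} = S"
  proof
    fix S assume "S \<in> Pow (reference_points x y z)"
    then have S: "S \<subseteq> reference_points x y z" by simp
    show "{p \<in> reference_points x y z. (p, partner x y z p) \<in> orient x y z S} = S"
      using mem_orient_iff(1)[OF S] S by blast
  qed
  show "orient x y z ` Pow (reference_points x y z) \<subseteq> {L. oriented_arrangement (x + z) (z + y) (x + y) L}"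
    using oriented_arrangement_orient by auto
  show "\<forall>L\<in>{L. oriented_arrangement (x + z) (z + y) (x + y) L}.
      orient x y z {p \<in> reference_points x y z. (p, partner x y z p) \<in> L} = L"
  proof
    fix L assume "L \<in> {L. oriented_arrangement (x + z) (z + y) (x + y) L}"
    then have "line_arrangement (x + z) (z + y) (x + y) ((\<lambda>(p, p'). {p, p'}) ` L)"
      and inj: "inj_on (\<lambda>(p, p'). {p, p'}) L"
      by (auto simp: oriented_arrangement_def)
    then have arcs: "(\<lambda>(p, p'). {p, p'}) ` L = standard_arcs x y z"
      using line_arrangement_unique by blast
    let ?S = "{p \<in> reference_points x y z. (p, partner x y z p) \<in> L}"
    have S: "?S \<subseteq> reference_points x y z" by auto
    show "orient x y z ?S = L"
    proof
      show "orient x y z ?S \<subseteq> L"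
      proof
        fix e assume "e \<in> orient x y z ?S"
        then consider p where "e = (p, partner x y z p)" "(p, partner x y z p) \<in> L"
          | p where "e = (partner x y z p, p)" "p \<in> reference_points x y z" "(p, partner x y z p) \<notin> L"
          by (auto simp: orient_def)
        then show "e \<in> L"
        proof cases
          case 2
          then have "{p, partner x y z p} \<in> (\<lambda>(p, p'). {p, p'}) ` L"
            unfolding arcs by (auto simp: standard_arcs_def)
          then obtain a b where "(a, b) \<in> L" "{p, partner x y z p} = {a, b}" by auto
          then show ?thesis using 2 by (auto simp: doubleton_eq_iff)
        qed simp
      qed
      show "L \<subseteq> orient x y z ?S"
      proof
        fix e assume e: "e \<in> L"
        obtain a b where ab: "e = (a, b)" by (cases e)
        have "{a, b} \<in> standard_arcs x y z" using e ab unfolding arcs[symmetric] by force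
        then obtain p where p: "p \<in> reference_points x y z" "{a, b} = {p, partner x y z p}"
          by (auto simp: standard_arcs_def)
        show "e \<in> orient x y z ?S"
        proof (cases "e = (p, partner x y z p)")
          case True
          then show ?thesis using e p mem_orient_iff(1)[OF S p(1)] by simp
        next
          case False
          then have "e = (partner x y z p, p)" using p ab by (auto simp: doubleton_eq_iff)
          moreover have "(p, partner x y z p) \<notin> L"
          proof
            assume "(p, partner x y z p) \<in> L"
            then have "(p, partner x y z p) = e"
              using inj_onD[OF inj, of "(p, partner x y z p)" "(partner x y z p, p)"] e \<open>e = (partner x y z p, p)\<close>
              by (simp add: insert_commute)
            then show False using False by simp
          qed
          ultimately show ?thesis using mem_orient_iff(2)[OF S p(1)] by simp
        qed
      qed
    qed
  qed
qed blast

section \<open>Arc counts of an orientation, bundle by bundle\<close>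

context
  fixes x y z :: nat and S T U :: "nat set"
  assumes S: "S \<subseteq> {x..<x + z}" and T: "T \<subseteq> {..<x}" and U: "U \<subseteq> {x + 2 * z..<x + 2 * z + y}"
begin

lemma subset_reference_points: "S \<union> (T \<union> U) \<subseteq> reference_points x y z"
  using S T U by (auto simp: reference_points_def)

lemma side_of_reference_points:
  "p \<in> {x..<x + z} \<Longrightarrow> side_of (x + z) (z + y) p = ISide"
  "p \<in> {x..<x + z} \<Longrightarrow> side_of (x + z) (z + y) (partner x y z p) = JSide"
  "p \<in> {..<x} \<Longrightarrow> side_of (x + z) (z + y) p = ISide"
  "p \<in> {..<x} \<Longrightarrow> side_of (x + z) (z + y) (partner x y z p) = KSide"
  "p \<in> {x + 2 * z..<x + 2 * z + y} \<Longrightarrow> side_of (x + z) (z + y) p = JSide"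
  "p \<in> {x + 2 * z..<x + 2 * z + y} \<Longrightarrow> side_of (x + z) (z + y) (partner x y z p) = KSide"
  by (auto simp: side_of_def partner_def)

text \<open>All arcs of a bundle join the same two sides, so \<open>Q\<close> is constant on each of
  its two orientations. Suitable choices of \<open>Q\<close> give the six arc counts, the parameters
  r, s, t and the sign.\<close>

lemma card_orient_sides:
  fixes Q :: "side \<Rightarrow> side \<Rightarrow> bool"
  shows "card {e \<in> orient x y z (S \<union> (T \<union> U)). Q (side_of (x + z) (z + y) (fst e)) (side_of (x + z) (z + y) (snd e))}
    = of_bool (Q ISide JSide) * card S + of_bool (Q JSide ISide) * (z - card S)
      + of_bool (Q ISide KSide) * card T + of_bool (Q KSide ISide) * (x - card T)
      + of_bool (Q JSide KSide) * card U + of_bool (Q KSide JSide) * (y - card U)"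
proof -
  let ?s = "side_of (x + z) (z + y)" and ?f = "partner x y z"
  have fin: "finite S" "finite T" "finite U" using S T U finite_subset by blast+
  have disj: "S \<inter> T = {}" "S \<inter> U = {}" "T \<inter> U = {}"
    using S T U by fastforce+
  have block: "card {p \<in> A. Q (?s p) (?s (?f p))} = of_bool (Q a b) * card A"
    and block': "card {p \<in> A. Q (?s (?f p)) (?s p)} = of_bool (Q b a) * card A"
    if "\<And>p. p \<in> A \<Longrightarrow> ?s p = a" "\<And>p. p \<in> A \<Longrightarrow> ?s (?f p) = b" for A a b
  proof -
    have "{p \<in> A. Q (?s p) (?s (?f p))} = (if Q a b then A else {})"
      "{p \<in> A. Q (?s (?f p)) (?s p)} = (if Q b a then A else {})" using that by auto
    then show "card {p \<in> A. Q (?s p) (?s (?f p))} = of_bool (Q a b) * card A"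
      "card {p \<in> A. Q (?s (?f p)) (?s p)} = of_bool (Q b a) * card A" by auto
  qed
  have card3: "card {p \<in> A \<union> (B \<union> C). P p} = card {p \<in> A. P p} + card {p \<in> B. P p} + card {p \<in> C. P p}"
    if "finite A" "finite B" "finite C" "A \<inter> B = {}" "A \<inter> C = {}" "B \<inter> C = {}" for A B C :: "nat set" and P
  proof -
    have "{p \<in> A \<union> (B \<union> C). P p} = {p \<in> A. P p} \<union> ({p \<in> B. P p} \<union> {p \<in> C. P p})" by auto
    moreover have "card \<dots> = card {p \<in> A. P p} + card ({p \<in> B. P p} \<union> {p \<in> C. P p})"
      by (rule card_Un_disjoint) (use that in auto)
    moreover have "card ({p \<in> B. P p} \<union> {p \<in> C. P p}) = card {p \<in> B. P p} + card {p \<in> C. P p}"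
      by (rule card_Un_disjoint) (use that in auto)
    ultimately show ?thesis by simp
  qed
  have diff: "reference_points x y z - (S \<union> (T \<union> U))
    = ({x..<x + z} - S) \<union> (({..<x} - T) \<union> ({x + 2 * z..<x + 2 * z + y} - U))"
    using S T U by (fastforce simp: reference_points_def)
  have "card {p \<in> S \<union> (T \<union> U). Q (?s p) (?s (?f p))}
    = of_bool (Q ISide JSide) * card S + of_bool (Q ISide KSide) * card T + of_bool (Q JSide KSide) * card U"
    unfolding card3[OF fin disj]
    using block[of S ISide JSide] block[of T ISide KSide] block[of U JSide KSide]
      side_of_reference_points S T U by (simp add: subset_iff)
  moreover have "card {p \<in> reference_points x y z - (S \<union> (T \<union> U)). Q (?s (?f p)) (?s p)}
    = of_bool (Q JSide ISide) * card ({x..<x + z} - S) + of_bool (Q KSide ISide) * card ({..<x} - T)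
      + of_bool (Q KSide JSide) * card ({x + 2 * z..<x + 2 * z + y} - U)"
    unfolding diff using side_of_reference_points
      block'[of "{x..<x + z} - S" ISide JSide] block'[of "{..<x} - T" ISide KSide]
      block'[of "{x + 2 * z..<x + 2 * z + y} - U" JSide KSide]
    by (subst card3) auto
  moreover have "card ({x..<x + z} - S) = z - card S" "card ({..<x} - T) = x - card T"
    "card ({x + 2 * z..<x + 2 * z + y} - U) = y - card U"
    using S T U fin by (simp_all add: card_Diff_subset)
  ultimately show ?thesis
    unfolding card_orient[OF subset_reference_points] by (simp add: fst_conv snd_conv)
qed

lemma arcs_from_to_orient:
  shows "arcs_from_to (x + z) (z + y) (orient x y z (S \<union> (T \<union> U))) ISide JSide = card S"
    and "arcs_from_to (x + z) (z + y) (orient x y z (S \<union> (T \<union> U))) JSide ISide = z - card S"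
    and "arcs_from_to (x + z) (z + y) (orient x y z (S \<union> (T \<union> U))) ISide KSide = card T"
    and "arcs_from_to (x + z) (z + y) (orient x y z (S \<union> (T \<union> U))) KSide ISide = x - card T"
    and "arcs_from_to (x + z) (z + y) (orient x y z (S \<union> (T \<union> U))) JSide KSide = card U"
    and "arcs_from_to (x + z) (z + y) (orient x y z (S \<union> (T \<union> U))) KSide JSide = y - card U"
proof -
  have eq: "arcs_from_to i j L A B = card {e \<in> L. side_of i j (fst e) = A \<and> side_of i j (snd e) = B}" for i j L A B
    unfolding arcs_from_to_def by (rule arg_cong[of _ _ card]) auto
  show "arcs_from_to (x + z) (z + y) (orient x y z (S \<union> (T \<union> U))) ISide JSide = card S"
    "arcs_from_to (x + z) (z + y) (orient x y z (S \<union> (T \<union> U))) JSide ISide = z - card S"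
    "arcs_from_to (x + z) (z + y) (orient x y z (S \<union> (T \<union> U))) ISide KSide = card T"
    "arcs_from_to (x + z) (z + y) (orient x y z (S \<union> (T \<union> U))) KSide ISide = x - card T"
    "arcs_from_to (x + z) (z + y) (orient x y z (S \<union> (T \<union> U))) JSide KSide = card U"
    "arcs_from_to (x + z) (z + y) (orient x y z (S \<union> (T \<union> U))) KSide JSide = y - card U"
    unfolding eq
    using card_orient_sides[of "\<lambda>a b. a = ISide \<and> b = JSide"] card_orient_sides[of "\<lambda>a b. a = JSide \<and> b = ISide"]
      card_orient_sides[of "\<lambda>a b. a = ISide \<and> b = KSide"] card_orient_sides[of "\<lambda>a b. a = KSide \<and> b = ISide"]
      card_orient_sides[of "\<lambda>a b. a = JSide \<and> b = KSide"] card_orient_sides[of "\<lambda>a b. a = KSide \<and> b = JSide"]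
    by simp_all
qed

lemma arrangement_orient_iff:
  "arrangement (x + z) (z + y) (x + y) r s t (orient x y z (S \<union> (T \<union> U)))
    \<longleftrightarrow> card S + card T = r \<and> card U + (z - card S) = s \<and> card T + card U = t"
  using card_orient_sides[of "\<lambda>a b. a = ISide"] card_orient_sides[of "\<lambda>a b. a = JSide"]
    card_orient_sides[of "\<lambda>a b. b = KSide"] oriented_arrangement_orient[OF subset_reference_points]
  by (simp add: arrangement_def add.commute)

lemma arrangement_sign_orient:
  "arrangement_sign (x + z) (z + y) (orient x y z (S \<union> (T \<union> U)))
    = (-1) ^ (card S + (x - card T) + (y - card U))"
  using card_orient_sides[of "\<lambda>a b. (a, b) \<in> {(ISide, JSide), (KSide, ISide), (KSide, JSide)}"]
  by (simp add: arrangement_sign_def negative_arc_def case_prod_beta)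

end

section \<open>From signed arrangements to binomial sums\<close>

lemma arrangementE:
  assumes "arrangement (x + z) (z + y) (x + y) r s t L"
  obtains S T U where "S \<subseteq> {x..<x + z}" "T \<subseteq> {..<x}" "U \<subseteq> {x + 2 * z..<x + 2 * z + y}"
    "L = orient x y z (S \<union> (T \<union> U))"
proof -
  have "L \<in> orient x y z ` Pow (reference_points x y z)"
    using assms bij_betw_imp_surj_on[OF bij_betw_orient] by (auto simp: arrangement_def)
  then obtain R where R: "R \<subseteq> reference_points x y z" "L = orient x y z R" by auto
  show thesis
  proof
    show "L = orient x y z (R \<inter> {x..<x + z} \<union> (R \<inter> {..<x} \<union> R \<inter> {x + 2 * z..<x + 2 * z + y}))"
      using R by (auto simp: reference_points_def intro!: arg_cong[of _ _ "orient x y z"])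
  qed auto
qed

lemma sum_Pow_Un:
  fixes f :: "'a set \<Rightarrow> 'b :: comm_monoid_add"
  assumes "A \<inter> B = {}"
  shows "sum f (Pow (A \<union> B)) = (\<Sum>S\<in>Pow A. \<Sum>T\<in>Pow B. f (S \<union> T))"
  unfolding sum.cartesian_product
  by (rule sum.reindex_bij_witness[of _ "\<lambda>(S, T). S \<union> T" "\<lambda>R. (R \<inter> A, R \<inter> B)"])
    (use assms in \<open>auto simp: Int_Un_distrib[symmetric] intro!: arg_cong[of _ _ f]\<close>)

lemma sum_Pow_card:
  fixes f :: "nat \<Rightarrow> int"
  assumes "finite A"
  shows "(\<Sum>S\<in>Pow A. f (card S)) = (\<Sum>a=0..card A. ibinom (card A) (int a) * f a)"
proof -
  have "(\<Sum>S\<in>Pow A. f (card S)) = (\<Sum>a=0..card A. \<Sum>S\<in>{S \<in> Pow A. card S = a}. f (card S))"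
    by (rule sum.group[symmetric]) (use assms card_mono in auto)
  also have "\<dots> = (\<Sum>a=0..card A. ibinom (card A) (int a) * f a)"
    using n_subsets[OF assms] by (intro sum.cong refl) (simp add: ibinom_def)
  finally show ?thesis .
qed

text \<open>Collapses the sums over subset sizes that r and s determine. For \<open>m\<close> out of
  range no index matches, in accordance with the convention for \<open>ibinom\<close>.\<close>

lemma sum_ibinom_delta:
  "(\<Sum>a=0..n. ibinom n (int a) * (if int a = m then c else 0)) = ibinom n m * c"
proof (cases "0 \<le> m \<and> m \<le> int n")
  case True
  then obtain l where "m = int l" "l \<le> n" by (metis nonneg_int_cases of_nat_le_iff)
  then show ?thesis by (simp add: if_distrib sum.delta cong: if_cong)
next
  case False
  then have "(\<Sum>a=0..n. ibinom n (int a) * (if int a = m then c else 0)) = 0"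
    by (intro sum.neutral) auto
  then show ?thesis using False by (auto simp: ibinom_def)
qed

lemma ibinom_symmetric: "ibinom n (int n - m) = ibinom n m"
  using binomial_symmetric[of "nat m" n] by (auto simp: ibinom_def nat_diff_distrib)

text \<open>The sources on the i- and j-sides number r + s; they comprise one for each of the
  \<open>z\<close> ij-arcs and one for each of the \<open>t\<close> arcs running into the
  k-side.\<close>

lemma Arr_eq_0:
  assumes "t + z \<noteq> r + s"
  shows "Arr (x + z) (z + y) (x + y) r s t = 0"
proof -
  have False if L: "arrangement (x + z) (z + y) (x + y) r s t L" for L
  proof -
    obtain S T U where *: "S \<subseteq> {x..<x + z}" "T \<subseteq> {..<x}" "U \<subseteq> {x + 2 * z..<x + 2 * z + y}"
      "L = orient x y z (S \<union> (T \<union> U))"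
      using arrangementE[OF L] .
    have "card S \<le> z" using card_mono[OF _ *(1)] by simp
    then show False using L assms unfolding *(4) arrangement_orient_iff[OF *(1-3)] by auto
  qed
  then show ?thesis unfolding Arr_def by (intro sum.neutral) blast
qed

lemma Arr_eq_sum:
  assumes t: "t + z = r + s"
  shows "Arr (x + z) (z + y) (x + y) r s t = (\<Sum>a=0..z. (-1) ^ (x + y + z + r + s + a)
      * ibinom z (int a) * ibinom x (int r - int a) * ibinom y (int (z + y) - int s - int a))"
proof -
  let ?C1 = "{x..<x + z}" and ?C2 = "{..<x}" and ?C3 = "{x + 2 * z..<x + 2 * z + y}"
  let ?w = "\<lambda>L. if arrangement (x + z) (z + y) (x + y) r s t L then arrangement_sign (x + z) (z + y) L else 0"
  let ?v = "\<lambda>a b c. (if a + b = r \<and> c + (z - a) = s \<and> b + c = t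
      then (-1) ^ (a + (x - b) + (y - c)) else 0) :: int"
  have y: "ibinom y (int s - int z + int a) = ibinom y (int (z + y) - int s - int a)" for a
    using ibinom_symmetric[of y "int s - int z + int a"] by (simp add: algebra_simps)
  have triple: "(\<Sum>S\<in>Pow ?C1. \<Sum>T\<in>Pow ?C2. \<Sum>U\<in>Pow ?C3. v (card S) (card T) (card U))
    = (\<Sum>a=0..z. ibinom z (int a) * (\<Sum>b=0..x. ibinom x (int b) * (\<Sum>c=0..y. ibinom y (int c) * v a b c)))"
    for v :: "nat \<Rightarrow> nat \<Rightarrow> nat \<Rightarrow> int"
    using sum_Pow_card[of ?C1 "\<lambda>a. \<Sum>T\<in>Pow ?C2. \<Sum>U\<in>Pow ?C3. v a (card T) (card U)"]
      sum_Pow_card[of ?C2 "\<lambda>b. \<Sum>U\<in>Pow ?C3. v a b (card U)" for a]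
      sum_Pow_card[of ?C3 "v a b" for a b] by simp
  have "{L. oriented_arrangement (x + z) (z + y) (x + y) L} \<subseteq> Pow ({..<x + z + (z + y) + (x + y)} \<times> {..<x + z + (z + y) + (x + y)})"
    using oriented_arrangement_subset by blast
  then have fin: "finite {L. oriented_arrangement (x + z) (z + y) (x + y) L}"
    by (rule finite_subset) simp
  have "Arr (x + z) (z + y) (x + y) r s t = (\<Sum>L | oriented_arrangement (x + z) (z + y) (x + y) L. ?w L)"
    unfolding Arr_def
    by (rule sum.mono_neutral_cong_left) (use fin in \<open>auto simp: arrangement_def\<close>)
  also have "\<dots> = (\<Sum>S\<in>Pow (reference_points x y z). ?w (orient x y z S))"
    by (rule sum.reindex_bij_betw[OF bij_betw_orient, symmetric])
  also have "\<dots> = (\<Sum>S\<in>Pow ?C1. \<Sum>T\<in>Pow ?C2. \<Sum>U\<in>Pow ?C3. ?w (orient x y z (S \<union> (T \<union> U))))"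
    unfolding reference_points_def by (subst sum_Pow_Un, fastforce)+ simp
  also have "\<dots> = (\<Sum>S\<in>Pow ?C1. \<Sum>T\<in>Pow ?C2. \<Sum>U\<in>Pow ?C3. ?v (card S) (card T) (card U))"
    by (intro sum.cong refl) (simp add: arrangement_orient_iff arrangement_sign_orient)
  also have "\<dots> = (\<Sum>a=0..z. ibinom z (int a) * (\<Sum>b=0..x. ibinom x (int b) * (\<Sum>c=0..y. ibinom y (int c) * ?v a b c)))"
    by (rule triple)
  \<comment> \<open>For given \<open>a\<close> the first two conditions force
    \<open>b = r - a\<close> and \<open>c = s - z + a\<close>; the third, \<open>b + c = t\<close>,
    then follows from the weight condition.\<close>
  also have "\<dots> = (\<Sum>a=0..z. ibinom z (int a) * (\<Sum>b=0..x. ibinom x (int b) * (if int b = int r - int a then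
      (\<Sum>c=0..y. ibinom y (int c) * (if int c = int s - int z + int a then (-1) ^ (x + y + z + r + s + a) else 0)) else 0)))"
  proof (intro sum.cong refl arg_cong2[of _ _ _ _ "(*)"])
    fix a b assume a: "a \<in> {0..z}" and b: "b \<in> {0..x}"
    show "(\<Sum>c=0..y. ibinom y (int c) * ?v a b c) = (if int b = int r - int a then
      (\<Sum>c=0..y. ibinom y (int c) * (if int c = int s - int z + int a then (-1) ^ (x + y + z + r + s + a) else 0)) else 0)"
    proof (cases "int b = int r - int a")
      case True
      have "?v a b c = (if int c = int s - int z + int a then (-1) ^ (x + y + z + r + s + a) else 0)"
        if "c \<in> {0..y}" for c
      proof (cases "int c = int s - int z + int a")
        case c: True
        then have eqs: "a + b = r" "c + (z - a) = s" "b + c = t" using True t a by auto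
        \<comment> \<open>The number of negative arcs differs from the exponent in the claim by an
          even number.\<close>
        then have e: "x + y + z + r + s + a = a + (x - b) + (y - c) + 2 * (b + c + z)"
          using a b that by auto
        have "(-1 :: int) ^ (x + y + z + r + s + a) = (-1) ^ (a + (x - b) + (y - c) + 2 * (b + c + z))"
          by (simp only: e)
        then show ?thesis using c eqs by (simp add: power_add power_mult)
      next
        case False
        then show ?thesis using a True by auto
      qed
      then show ?thesis using True by simp
    next
      case False
      then show ?thesis by (auto intro!: sum.neutral)
    qed
  qed
  also have "\<dots> = (\<Sum>a=0..z. (-1) ^ (x + y + z + r + s + a)
      * ibinom z (int a) * ibinom x (int r - int a) * ibinom y (int (z + y) - int s - int a))"
    unfolding sum_ibinom_delta y by (simp only: mult_ac)
  finally show ?thesis .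
qed

text \<open>Every factor of \<open>exponent\<close> is an arc count: \<open>z - a\<close> is N_ji,
  \<open>r - a\<close> is N_ik, \<open>x - r + a\<close> is N_ki, both \<open>y - s + z - a\<close>
  and \<open>j - s - a\<close> are N_kj, and \<open>y - j + s + a\<close> is N_jk.\<close>

lemma exponent_eq_arcs:
  assumes L: "arrangement (x + z) (z + y) (x + y) r s t L"
    and a: "arcs_from_to (x + z) (z + y) L ISide JSide = a"
  defines "N \<equiv> \<lambda>A B. int (arcs_from_to (x + z) (z + y) L A B)"
  shows "exponent (int x) (int y) (int z) (int (z + y)) (int r) (int s) (int a)
    = N JSide ISide * N KSide JSide + N ISide KSide * N KSide JSide
      + N ISide KSide * N KSide ISide + N ISide KSide * N JSide ISide
      + N ISide JSide * N JSide ISide + N KSide JSide * N JSide KSide"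
proof -
  obtain S T U where *: "S \<subseteq> {x..<x + z}" "T \<subseteq> {..<x}" "U \<subseteq> {x + 2 * z..<x + 2 * z + y}"
    "L = orient x y z (S \<union> (T \<union> U))"
    using arrangementE[OF L] .
  have le: "card S \<le> z" "card T \<le> x" "card U \<le> y"
    using card_mono[OF _ *(1)] card_mono[OF _ *(2)] card_mono[OF _ *(3)] by auto
  have N: "N ISide JSide = int (card S)" "N JSide ISide = int z - int (card S)"
    "N ISide KSide = int (card T)" "N KSide ISide = int x - int (card T)"
    "N JSide KSide = int (card U)" "N KSide JSide = int y - int (card U)"
    unfolding N_def *(4) arcs_from_to_orient[OF *(1-3)] using le by auto
  have "int a = int (card S)" "int r = int (card S) + int (card T)" "int s = int (card U) + (int z - int (card S))"
    using L a le unfolding *(4) arcs_from_to_orient[OF *(1-3)] arrangement_orient_iff[OF *(1-3)] by auto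
  then show ?thesis
    unfolding N exponent_def by (simp add: algebra_simps)
qed

theorem theorem8:
  fixes i j k x y z r s t :: nat
  assumes "k mod 2 = (i + j) mod 2" and "j \<le> i + k" and "i \<le> j + k" and "k \<le> i + j"
    and "z = (i + j - k) div 2" and "x = (i + k - j) div 2" and "y = (j + k - i) div 2"
    and "r \<le> i" and "s \<le> j" and "t \<le> k"
  shows
    "(regular_at 1 (threej i j k r s t) \<and>
      specialize 1 (threej i j k r s t)
        = of_int ((-1) ^ ((i + j + k) div 2 + r + s) * Arr i j k r s t) \<and>
      (t + z = r + s \<longrightarrow>
        specialize 1 (threej i j k r s t)
          = of_int (\<Sum>a=0..z. (-1) ^ a * ibinom z (int a) * ibinom x (int r - int a)
                             * ibinom y (int j - int s - int a)))) \<and>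
     ((t + z = r + s \<longrightarrow>
        dual_coord k (intertwiner i j k (basis_tensor r s)) t
          = q powi (- int (t * (k - t))) *
            (\<Sum>a=0..z. (-1) ^ a * q powi (- int a) * q powi exponent x y z j r s a
               * qbinom z (int a) * qbinom x (int r - int a) * qbinom y (int j - int s - int a)) \<and>
        threej i j k r s t
          = (\<Sum>a=0..z. (-1) ^ a * q powi (- int a) * q powi exponent x y z j r s a
               * qbinom z (int a) * qbinom x (int r - int a) * qbinom y (int j - int s - int a)))) \<and>
     (t + z \<noteq> r + s \<longrightarrow> threej i j k r s t = 0 \<and> Arr i j k r s t = 0) \<and>
     (\<forall>L a. arrangement i j k r s t L \<and> arcs_from_to i j L ISide JSide = a \<longrightarrow>
        (let N = (\<lambda>A B. int (arcs_from_to i j L A B)) in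
          exponent x y z j r s a
            = N JSide ISide * N KSide JSide + N ISide KSide * N KSide JSide
              + N ISide KSide * N KSide ISide + N ISide KSide * N JSide ISide
              + N ISide JSide * N JSide ISide + N KSide JSide * N JSide KSide))"
proof -
  \<comment> \<open>Parity makes the three halves exact, so that i, j, k can be recovered from x, y,
    z.\<close>
  have "even (i + j + k)"
    using assms(1) by presburger
  then have "even (i + j - k)" "even (i + k - j)" "even (j + k - i)"
    using assms(2-4) by presburger+
  then have "i + j - k = 2 * z" "i + k - j = 2 * x" "j + k - i = 2 * y"
    unfolding assms(5-7) by simp_all
  then have i: "i = x + z" and j: "j = z + y" and k: "k = x + y"
    using assms(2-4) by linarith+
  note bounds = \<open>r \<le> i\<close>[unfolded i] \<open>s \<le> j\<close>[unfolded j] \<open>t \<le> k\<close>[unfolded k]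
  let ?C = "threej i j k r s t"
  let ?classical = "\<Sum>a=0..z. (-1) ^ a * ibinom z (int a) * ibinom x (int r - int a)
                             * ibinom y (int j - int s - int a)"
  let ?quantum = "\<Sum>a=0..z. (-1) ^ a * q powi (- int a) * q powi exponent x y z j r s a
               * qbinom z (int a) * qbinom x (int r - int a) * qbinom y (int j - int s - int a)"
  have sgn: "(i + j + k) div 2 = x + y + z" by (simp add: i j k)
  have zero: "?C = 0 \<and> Arr i j k r s t = 0" if "t + z \<noteq> r + s"
    unfolding i j k using threej_eq_0[OF bounds that] Arr_eq_0[OF that] by simp
  have quantum: "?C = ?quantum" if "t + z = r + s"
    unfolding i j k using threej_eq_sum[OF bounds that] .
  have coord: "dual_coord k (intertwiner i j k (basis_tensor r s)) t = q powi (- int (t * (k - t))) * ?quantum"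
    if "t + z = r + s"
    unfolding quantum[OF that, symmetric]
    unfolding threej_eq_dual_coord[OF \<open>t \<le> k\<close>] power_int_minus power_int_of_nat by simp
  have classical: "specializes 1 ?C (of_int ?classical)" if "t + z = r + s"
    unfolding i j k using specializes_threej[OF bounds that] .
  have Arr: "(-1) ^ (x + y + z + r + s) * Arr i j k r s t = ?classical" if "t + z = r + s"
  proof -
    have "(-1) ^ N * ((-1) ^ (N + a) * u * v * w) = (-1) ^ a * u * v * w" for N a :: nat and u v w :: int
      by (simp add: power_add flip: power_mult_distrib)
    then show ?thesis
      unfolding i j k Arr_eq_sum[OF that] sum_distrib_left by (simp only:)
  qed
  have Arr_spec: "specializes 1 ?C (of_int ((-1) ^ ((i + j + k) div 2 + r + s) * Arr i j k r s t))"
  proof (cases "t + z = r + s")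
    case True
    then show ?thesis using classical Arr sgn by simp
  next
    case False
    then show ?thesis using zero specializes_0 by simp
  qed
  show ?thesis
  proof (intro conjI impI allI)
    show "regular_at 1 ?C"
      and "specialize 1 ?C = of_int ((-1) ^ ((i + j + k) div 2 + r + s) * Arr i j k r s t)"
      using Arr_spec by (simp_all only: specializes_def)
    show "specialize 1 ?C = of_int ?classical" if "t + z = r + s"
      using classical[OF that] by (simp only: specializes_def)
  next
    fix L a
    assume L: "arrangement i j k r s t L \<and> arcs_from_to i j L ISide JSide = a"
    show "let N = (\<lambda>A B. int (arcs_from_to i j L A B)) in
        exponent x y z j r s a
          = N JSide ISide * N KSide JSide + N ISide KSide * N KSide JSide
            + N ISide KSide * N KSide ISide + N ISide KSide * N JSide ISide
            + N ISide JSide * N JSide ISide + N KSide JSide * N JSide KSide"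
      using exponent_eq_arcs[OF conjunct1[OF L[unfolded i j k]] conjunct2[OF L[unfolded i j k]]]
      unfolding i j k Let_def .
  qed (use zero quantum coord in simp_all)
qed

end
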